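(* Any lift of $\rho_2:G_{\mathbb Q}\to GL(2,W/4W)$ to a (continuous) representation $\rho:G_{\mathbb Q}\to GL(2,W)$ with $\rho\equiv\rho_2\bmod 4$ is irreducible.
   Context: $W=W(\mathbb F_4)$ is the ring of Witt vectors of $\mathbb F_4$. $K$ is the cyclic cubic totally real subfield of $\mathbb Q(\zeta_7)$. Fix a generator of $\mathrm{Gal}(K/\mathbb Q)$ and a primitive cube root of unity $\alpha\in\mathbb F_4$; $\psi:G_{\mathbb Q}\to\mathbb F_4^\times$ is the character factoring through $\mathrm{Gal}(K/\mathbb Q)$ sending the generator to $\alpha$; $\widetilde\psi:G_{\mathbb Q}\to W^\times$ is its Teichmüller lift. $\overline\rho=\mathrm{diag}(\psi,\psi^{-1}):G_{\mathbb Q}\to GL(2,\mathbb F_4)$, $Ad(\overline\rho)=M_2(\mathbb F_4)$ with Galois acting through $\overline\rho$ by conjugation; $E_{ij}$ are the elementary matrices, and $\mathbb F_4E_{12}=\mathbb F_4(\psi^{-1})$, $\mathbb F_4E_{21}=\mathbb F_4(\psi)$ as Galois modules. A prime $p$ is trivial if $p\equiv3\bmod4$ and $p$ splits completely in $K$. The governing field of $K$ is $K(\sqrt{U_K})$ (adjoin square roots of all units of $K$), with $\mathrm{Gal}(K(\sqrt{U_K})/K)\simeq\mathbb F_2\oplus U_2$ as $\mathrm{Gal}(K/\mathbb Q)$-module, $\mathbb F_2$ trivial, $U_2$ irreducible of dimension 2. $K^{(p)}$ is the maximal elementary abelian 2-extension of $K$ unramified (also at archimedean places) outside the primes above $p$;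 for trivial $p$ whose Frobenius in the governing field at primes above $p$ is $(1,0)$, $\mathrm{Gal}(K^{(p)}/K)$ is isomorphic to both $\mathbb F_4(\psi)$ and $\mathbb F_4(\psi^{-1})$. $l$ is a prime that stays prime in $K$ with $l\equiv1\bmod8$; $v$ is a trivial prime with Frobenius $(1,0)$ in the governing field that stays prime in $\mathbb Q(\sqrt l)$; $w$ is a trivial prime with Frobenius $(1,0)$ that stays prime in $\mathbb Q(\sqrt l)$ and splits completely in $K^{(v)}$. $f^{(v)}\in H^1(G_{\mathbb Q},\mathbb F_4E_{12})$, resp. $f^{(w)}\in H^1(G_{\mathbb Q},\mathbb F_4E_{21})$, is the class whose restriction to $\ker\overline\rho$ is the projection to $\mathrm{Gal}(K^{(v)}/K)\simeq\mathbb F_4(\psi^{-1})$, resp. $\mathrm{Gal}(K^{(w)}/K)\simeq\mathbb F_4(\psi)$. $\chi_l:G_{\mathbb Q}\to\mathbb F_2$ is the additive quadratic character of $\mathbb Q(\sqrt l)$; $\xi_2=\mathrm{diag}(\widetilde\psi(1+2\chi_l),\widetilde\psi^{-1})\bmod4$; $\rho_2=(I+2(f^{(v)}+f^{(w)}))\xi_2$. Definition: for a ring $R$, a representation $\rho:G_{\mathbb Q}\to GL(2,R)$ on $M=R^2$ is reducible if there are free rank-one $R$-modules $M_1,M_2$ with $M_1$ $G_{\mathbb Q}$-stable and $M=M_1\oplus M_2$ (as $R$-modules); it is irreducible if it is not reducible. *)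

theory Defs
  imports
    "HOL-Analysis.Analysis"
    "HOL-Library.Z2"
    "HOL-Algebra.Algebraic_Closure_Type"
    "HOL-Algebra.Generated_Fields"
    "HOL-Algebra.Ideal_Product"
    "HOL-Algebra.Bij"
begin

section \<open>The field with four elements\<close>

text \<open>\<open>F4 a b\<close> stands for \<open>a + b \<omega>\<close> with \<open>\<omega>\<^sup>2 + \<omega> + 1 = 0\<close> over the field \<^typ>\<open>bit\<close>.\<close>

datatype f4 = F4 bit bit

instantiation f4 :: field
begin
definition "0 = F4 0 0"
definition "1 = F4 1 0"
fun plus_f4 where "F4 a b + F4 c d = F4 (a + c) (b + d)"
definition "- x = (x :: f4)"
definition "x - y = x + (y :: f4)"
fun times_f4 where "F4 a b * F4 c d = F4 (a * c + b * d) (a * d + b * c + b * d)"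
definition "inverse x = x * (x :: f4)"
definition "divide x y = x * inverse (y :: f4)"
instance
proof
  fix a b c :: f4
  show "a * b * c = a * (b * c)" by (cases a; cases b; cases c) (simp only: f4.inject plus_f4.simps times_f4.simps algebra_simps simp_thms)
  show "a * b = b * a" by (cases a; cases b) (simp only: f4.inject plus_f4.simps times_f4.simps algebra_simps simp_thms)
  show "1 * a = a" by (cases a) (auto simp: one_f4_def)
  show "a + b + c = a + (b + c)" by (cases a; cases b; cases c) (simp only: f4.inject plus_f4.simps times_f4.simps algebra_simps simp_thms)
  show "a + b = b + a" by (cases a; cases b) (simp only: f4.inject plus_f4.simps times_f4.simps algebra_simps simp_thms)
  show "0 + a = a" by (cases a) (auto simp: zero_f4_def)
  show "- a + a = 0" by (cases a) (auto simp: zero_f4_def uminus_f4_def)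
  show "a - b = a + - b" by (simp add: minus_f4_def uminus_f4_def)
  show "(a + b) * c = a * c + b * c"
    by (cases a; cases b; cases c) (simp only: f4.inject plus_f4.simps times_f4.simps algebra_simps simp_thms)
  show "(0::f4) \<noteq> 1" by (simp add: zero_f4_def one_f4_def)
  show "a \<noteq> 0 \<Longrightarrow> inverse a * a = 1"
  proof (cases a)
    case (F4 x y)
    then show "a \<noteq> 0 \<Longrightarrow> inverse a * a = 1"
      by (cases x; cases y) (auto simp: zero_f4_def one_f4_def inverse_f4_def)
  qed
  show "a div b = a * inverse b" by (simp add: divide_f4_def)
  show "inverse (0::f4) = 0" by (simp add: inverse_f4_def zero_f4_def)
qed
end

section \<open>The ring of Witt vectors of the field with four elements\<close>

text \<open>
  The Eisenstein integers, \<open>Eis a b = a + b \<omega>\<close>: a torsion-free ring mapping onto \<^typ>\<open>f4\<close>.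
  Its Witt vectors have injective ghost map, and by functoriality they map onto the Witt
  vectors of \<^typ>\<open>f4\<close>.
\<close>

datatype eis = Eis int int

instantiation eis :: comm_ring_1
begin
definition "0 = Eis 0 0"
definition "1 = Eis 1 0"
fun plus_eis where "Eis a b + Eis c d = Eis (a + c) (b + d)"
fun uminus_eis where "- Eis a b = Eis (- a) (- b)"
fun minus_eis where "Eis a b - Eis c d = Eis (a - c) (b - d)"
fun times_eis where "Eis a b * Eis c d = Eis (a * c - b * d) (a * d + b * c - b * d)"
instance
proof
  fix a b c :: eis
  show "a * b * c = a * (b * c)" by (cases a; cases b; cases c) (simp add: algebra_simps)
  show "a * b = b * a" by (cases a; cases b) (simp add: algebra_simps)
  show "1 * a = a" by (cases a) (auto simp: one_eis_def)
  show "a + b + c = a + (b + c)" by (cases a; cases b; cases c) (simp add: algebra_simps)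
  show "a + b = b + a" by (cases a; cases b) (simp add: algebra_simps)
  show "0 + a = a" by (cases a) (auto simp: zero_eis_def)
  show "- a + a = 0" by (cases a) (auto simp: zero_eis_def)
  show "a - b = a + - b" by (cases a; cases b) (auto)
  show "(a + b) * c = a * c + b * c"
    by (cases a; cases b; cases c) (simp add: algebra_simps)
  show "(0::eis) \<noteq> 1" by (simp add: zero_eis_def one_eis_def)
qed
end

fun eis_red :: "eis \<Rightarrow> f4" where
  "eis_red (Eis a b) = F4 (of_int a) (of_int b)"

definition ghost :: "(nat \<Rightarrow> eis) \<Rightarrow> nat \<Rightarrow> eis" where
  "ghost u n = (\<Sum>i\<le>n. 2 ^ i * u i ^ (2 ^ (n - i)))"

datatype witt = Witt (wcomp: "nat \<Rightarrow> f4")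

text \<open>
  The Witt vector operation which on ghost components (of lifts to Eisenstein integers) is \<open>h\<close>;
  used for \<open>h\<close> = addition, subtraction, multiplication.
\<close>

definition witt_op :: "(eis \<Rightarrow> eis \<Rightarrow> eis) \<Rightarrow> witt \<Rightarrow> witt \<Rightarrow> witt" where
  "witt_op h x y = (THE z. \<exists>u v w.
     eis_red \<circ> u = wcomp x \<and> eis_red \<circ> v = wcomp y \<and> eis_red \<circ> w = wcomp z \<and>
     (\<forall>n. ghost w n = h (ghost u n) (ghost v n)))"

fun eis_conj :: "eis \<Rightarrow> eis" where
  "eis_conj (Eis a b) = Eis (a - b) (- b)"

lemma eis_conj_add: "eis_conj (x + y) = eis_conj x + eis_conj y"
  by (cases x; cases y) auto
lemma eis_conj_diff: "eis_conj (x - y) = eis_conj x - eis_conj y"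
  by (cases x; cases y) auto
lemma eis_conj_mult: "eis_conj (x * y) = eis_conj x * eis_conj y"
  by (cases x; cases y) (simp add: algebra_simps)
lemma eis_conj_0: "eis_conj 0 = 0" and eis_conj_1: "eis_conj 1 = 1"
  by (auto simp: zero_eis_def one_eis_def)
lemma eis_conj_power: "eis_conj (x ^ n) = eis_conj x ^ n"
  by (induction n) (auto simp: eis_conj_mult eis_conj_1)
lemma eis_conj_sum: "eis_conj (sum f A) = (\<Sum>i\<in>A. eis_conj (f i))"
  by (induction A rule: infinite_finite_induct) (auto simp: eis_conj_add eis_conj_0)

lemma eis_2: "(2::eis) = Eis 2 0"
proof -
  have "(2::eis) = 1 + 1" by simp
  also have "\<dots> = Eis 2 0" by (simp add: one_eis_def del: one_add_one)
  finally show ?thesis .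
qed

lemma eis_2_power: "(2::eis) ^ n = Eis (2 ^ n) 0"
  by (induction n) (auto simp: one_eis_def eis_2)

lemma eis_conj_2: "eis_conj 2 = 2"
  by (simp add: eis_2)

lemma eis_conj_2_power: "eis_conj (2 ^ n) = 2 ^ n"
  by (simp add: eis_2_power)

lemma eis_2_power_dvd: "2 ^ n dvd Eis a b \<longleftrightarrow> 2 ^ n dvd a \<and> 2 ^ n dvd b"
proof
  assume "2 ^ n dvd Eis a b"
  then obtain c where "Eis a b = 2 ^ n * c" by blast
  then show "2 ^ n dvd a \<and> 2 ^ n dvd b" by (cases c) (auto simp: eis_2_power)
next
  assume "2 ^ n dvd a \<and> 2 ^ n dvd b"
  then obtain c d where "a = 2 ^ n * c" "b = 2 ^ n * d" by blast
  then have "Eis a b = 2 ^ n * Eis c d" by (auto simp: eis_2_power)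
  then show "2 ^ n dvd Eis a b" by simp
qed

lemma eis_2_power_cancel: "2 ^ n * x = 2 ^ n * (y::eis) \<longleftrightarrow> x = y"
proof (cases x)
  case x: (Eis a b)
  show ?thesis by (cases y) (simp add: x eis_2_power)
qed

lemma eis_2_power_dvd_cancel: "2 ^ (n + k) dvd 2 ^ n * (x::eis) \<longleftrightarrow> 2 ^ k dvd x"
  unfolding dvd_def power_add mult.assoc eis_2_power_cancel ..

lemma of_int_bit: "(of_int m :: bit) = of_bool (odd m)"
proof (cases "even m")
  case True
  then obtain k where "m = 2 * k" by (elim evenE)
  then show ?thesis by simp
next
  case False
  then obtain k where "m = 2 * k + 1" by (elim oddE)
  then show ?thesis by simp
qed

lemma eis_red_eq_iff: "eis_red x = eis_red y \<longleftrightarrow> 2 dvd x - y"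
proof (cases x; cases y)
  fix a b c d assume xy: "x = Eis a b" "y = Eis c d"
  have *: "(of_int m :: bit) = of_int k \<longleftrightarrow> 2 dvd m - k" for m k :: int
    by (simp add: of_int_bit)
  show ?thesis using eis_2_power_dvd[of 1 "a - c" "b - d"] by (simp add: xy *)
qed

lemma eis_frobenius: "2 dvd x ^ 2 - eis_conj x"
proof (cases x)
  case (Eis a b)
  have "even (a * a - b * b - (a - b))" by simp
  moreover have "even (a * b + b * a - b * b + b)" by simp
  ultimately show ?thesis
    using eis_2_power_dvd[of 1] by (simp add: Eis power2_eq_square)
qed

lemma eis_cong_power:
  assumes "2 dvd a - (b::eis)" shows "2 ^ Suc k dvd a ^ (2 ^ k) - b ^ (2 ^ k)"
proof (induction k)
  case 0
  then show ?case using assms by simp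
next
  case (Suc k)
  define A B where "A = a ^ (2 ^ k)" and "B = b ^ (2 ^ k)"
  have d: "2 ^ Suc k dvd A - B" using Suc by (simp add: A_def B_def)
  then have "2 dvd A - B" by (metis dvd_mult_left power_Suc)
  then have "2 dvd (A - B) + 2 * B" by (rule dvd_add) simp
  then have "2 dvd A + B" by (simp add: algebra_simps)
  with d have "2 ^ Suc k * 2 dvd (A - B) * (A + B)" by (rule mult_dvd_mono)
  moreover have "(A - B) * (A + B) = a ^ (2 ^ Suc k) - b ^ (2 ^ Suc k)"
    by (simp add: A_def B_def algebra_simps flip: power_add mult_2)
  ultimately show ?case by (simp add: mult.commute)
qed

definition dwork :: "(nat \<Rightarrow> eis) \<Rightarrow> bool" where
  "dwork g \<longleftrightarrow> (\<forall>n. 2 ^ Suc n dvd g (Suc n) - eis_conj (g n))"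

lemma eis_2_power_split: "i \<le> n \<Longrightarrow> (2::eis) ^ Suc n = 2 ^ i * 2 ^ Suc (n - i)"
  by (simp only: power_add [symmetric]) simp

lemma ghost_step:
  "2 ^ Suc n dvd (\<Sum>i\<le>n. 2 ^ i * u i ^ (2 ^ (Suc n - i))) - eis_conj (ghost u n)"
proof -
  have "(\<Sum>i\<le>n. 2 ^ i * u i ^ (2 ^ (Suc n - i))) - eis_conj (ghost u n) =
      (\<Sum>i\<le>n. 2 ^ i * ((u i ^ 2) ^ (2 ^ (n - i)) - eis_conj (u i) ^ (2 ^ (n - i))))"
    by (simp add: ghost_def eis_conj_sum eis_conj_2 eis_conj_mult eis_conj_2_power eis_conj_power
        right_diff_distrib sum_subtractf Suc_diff_le flip: power_mult)
  also have "2 ^ Suc n dvd \<dots>"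
  proof (rule dvd_sum)
    fix i assume "i \<in> {..n}"
    then have "(2::eis) ^ Suc n = 2 ^ i * 2 ^ Suc (n - i)" by (intro eis_2_power_split) simp
    then show "2 ^ Suc n dvd 2 ^ i * ((u i ^ 2) ^ (2 ^ (n - i)) - eis_conj (u i) ^ (2 ^ (n - i)))"
      using mult_dvd_mono[OF dvd_refl eis_cong_power[OF eis_frobenius]] by (simp only:)
  qed
  finally show ?thesis .
qed

lemma ghost_Suc:
  "ghost u (Suc n) = (\<Sum>i\<le>n. 2 ^ i * u i ^ (2 ^ (Suc n - i))) + 2 ^ Suc n * u (Suc n)"
  by (simp add: ghost_def)

lemma dwork_ghost: "dwork (ghost u)"
  unfolding dwork_def
proof
  fix n
  have "2 ^ Suc n dvd ((\<Sum>i\<le>n. 2 ^ i * u i ^ (2 ^ (Suc n - i))) - eis_conj (ghost u n)) +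
      2 ^ Suc n * u (Suc n)"
    by (rule dvd_add[OF ghost_step dvd_triv_left])
  then show "2 ^ Suc n dvd ghost u (Suc n) - eis_conj (ghost u n)"
    unfolding ghost_Suc by (simp only: algebra_simps)
qed

function unghost :: "(nat \<Rightarrow> eis) \<Rightarrow> nat \<Rightarrow> eis" where
  "unghost g n = (SOME c. 2 ^ n * c = g n - (\<Sum>i\<leftarrow>[0..<n]. 2 ^ i * unghost g i ^ (2 ^ (n - i))))"
  by pat_completeness simp
termination
proof (relation "Wellfounded.measure snd", goal_cases)
  case 1
  show ?case by simp
next
  case (2 g n c i)
  then show ?case by simp
qed

declare unghost.simps [simp del]

lemma ghost_unghost:
  assumes "dwork g" shows "ghost (unghost g) = g"
proof
  fix n
  show "ghost (unghost g) n = g n"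
  proof (induction n)
    case 0
    have "unghost g 0 = g 0" by (subst unghost.simps) simp
    then show ?case by (simp add: ghost_def)
  next
    case (Suc n)
    let ?s = "\<Sum>i\<le>n. 2 ^ i * unghost g i ^ (2 ^ (Suc n - i))"
    have "2 ^ Suc n dvd (g (Suc n) - eis_conj (g n)) - (?s - eis_conj (ghost (unghost g) n))"
      by (rule dvd_diff[OF assms[unfolded dwork_def, rule_format] ghost_step])
    moreover have "(a - e) - (b - e) = a - b" for a b e :: eis by simp
    ultimately have "2 ^ Suc n dvd g (Suc n) - ?s" unfolding Suc by (simp only:)
    then have ex: "\<exists>c. 2 ^ Suc n * c = g (Suc n) - ?s" unfolding dvd_def by (elim exE) (rule exI, erule sym)
    have s: "(\<Sum>i\<leftarrow>[0..<Suc n]. 2 ^ i * unghost g i ^ (2 ^ (Suc n - i))) = ?s"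
      by (simp only: interv_sum_list_conv_sum_set_nat set_upt atLeast0LessThan lessThan_Suc_atMost)
    have "2 ^ Suc n * unghost g (Suc n) = g (Suc n) - ?s"
      unfolding unghost.simps[of g "Suc n"] s using someI_ex[OF ex] .
    then show ?case unfolding ghost_Suc by simp
  qed
qed

lemma ghost_cong_iff:
  "(\<forall>n. eis_red (u n) = eis_red (v n)) \<longleftrightarrow> (\<forall>n. 2 ^ Suc n dvd ghost u n - ghost v n)"
proof
  assume *: "\<forall>n. eis_red (u n) = eis_red (v n)"
  show "\<forall>n. 2 ^ Suc n dvd ghost u n - ghost v n"
  proof
    fix n
    have "ghost u n - ghost v n = (\<Sum>i\<le>n. 2 ^ i * (u i ^ (2 ^ (n - i)) - v i ^ (2 ^ (n - i))))"
      by (simp add: ghost_def right_diff_distrib sum_subtractf)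
    also have "2 ^ Suc n dvd \<dots>"
    proof (rule dvd_sum)
      fix i assume "i \<in> {..n}"
      then have "(2::eis) ^ Suc n = 2 ^ i * 2 ^ Suc (n - i)" by (intro eis_2_power_split) simp
      moreover have "2 dvd u i - v i" using * by (simp add: eis_red_eq_iff)
      ultimately show "2 ^ Suc n dvd 2 ^ i * (u i ^ (2 ^ (n - i)) - v i ^ (2 ^ (n - i)))"
        using mult_dvd_mono[OF dvd_refl eis_cong_power] by (simp only:)
    qed
    finally show "2 ^ Suc n dvd ghost u n - ghost v n" .
  qed
next
  assume *: "\<forall>n. 2 ^ Suc n dvd ghost u n - ghost v n"
  show "\<forall>n. eis_red (u n) = eis_red (v n)"
  proof
    fix n
    show "eis_red (u n) = eis_red (v n)"
    proof (induction n rule: less_induct)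
      case (less n)
      have d: "2 ^ Suc n dvd (\<Sum>i<n. 2 ^ i * (u i ^ (2 ^ (n - i)) - v i ^ (2 ^ (n - i))))"
      proof (rule dvd_sum)
        fix i assume i: "i \<in> {..<n}"
        then have "(2::eis) ^ Suc n = 2 ^ i * 2 ^ Suc (n - i)" by (intro eis_2_power_split) simp
        moreover have "2 dvd u i - v i" using less i by (simp add: eis_red_eq_iff)
        ultimately show "2 ^ Suc n dvd 2 ^ i * (u i ^ (2 ^ (n - i)) - v i ^ (2 ^ (n - i)))"
          using mult_dvd_mono[OF dvd_refl eis_cong_power] by (simp only:)
      qed
      have "ghost u n - ghost v n =
          (\<Sum>i<n. 2 ^ i * (u i ^ (2 ^ (n - i)) - v i ^ (2 ^ (n - i)))) + 2 ^ n * (u n - v n)"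
        by (simp add: ghost_def right_diff_distrib sum_subtractf flip: lessThan_Suc_atMost)
      with * have "2 ^ Suc n dvd (\<Sum>i<n. 2 ^ i * (u i ^ (2 ^ (n - i)) - v i ^ (2 ^ (n - i)))) +
          2 ^ n * (u n - v n)"
        by metis
      then have "2 ^ (n + 1) dvd 2 ^ n * (u n - v n)"
        unfolding dvd_add_right_iff[OF d] by simp
      then have "2 ^ 1 dvd u n - v n" unfolding eis_2_power_dvd_cancel .
      then show ?case unfolding eis_red_eq_iff by simp
    qed
  qed
qed

definition wrep :: "(nat \<Rightarrow> eis) \<Rightarrow> witt \<Rightarrow> bool" where
  "wrep u x \<longleftrightarrow> eis_red \<circ> u = wcomp x"

lemma eis_red_surj: "\<exists>e. eis_red e = c"
proof (cases c)
  case (F4 a b)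
  have "\<exists>k. of_int k = d" for d :: bit
    by (cases d) (metis of_int_0, metis of_int_1)
  then obtain i j where "of_int i = a" "of_int j = b" by metis
  with F4 show ?thesis by (intro exI[of _ "Eis i j"]) simp
qed

lemma wrep_exists: "\<exists>u. wrep u x"
proof -
  have "\<exists>u. \<forall>n. eis_red (u n) = wcomp x n" by (rule choice) (simp add: eis_red_surj)
  then show ?thesis by (auto simp: wrep_def fun_eq_iff)
qed

lemma wrep_eq_iff:
  assumes "wrep u x" "wrep v y"
  shows "x = y \<longleftrightarrow> (\<forall>n. 2 ^ Suc n dvd ghost u n - ghost v n)"
proof -
  have "x = y \<longleftrightarrow> (\<forall>n. eis_red (u n) = eis_red (v n))"
    using assms by (cases x; cases y) (auto simp: wrep_def fun_eq_iff)
  then show ?thesis by (simp only: ghost_cong_iff)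
qed

lemma wrep_eqI: "wrep u x \<Longrightarrow> wrep v y \<Longrightarrow> (\<And>n. ghost u n = ghost v n) \<Longrightarrow> x = y"
  using wrep_eq_iff[of u x v y] by simp

lemma witt_op_rep:
  assumes dw: "\<And>a b. dwork a \<Longrightarrow> dwork b \<Longrightarrow> dwork (\<lambda>n. h (a n) (b n))"
  assumes cong: "\<And>k a a' b b'. (2::eis) ^ k dvd a - a' \<Longrightarrow> 2 ^ k dvd b - b' \<Longrightarrow> 2 ^ k dvd h a b - h a' b'"
  assumes "wrep u x" "wrep v y"
  shows "\<exists>w. wrep w (witt_op h x y) \<and> (\<forall>n. ghost w n = h (ghost u n) (ghost v n))"
proof -
  let ?P = "\<lambda>z. \<exists>u v w. wrep u x \<and> wrep v y \<and> wrep w z \<and> (\<forall>n. ghost w n = h (ghost u n) (ghost v n))"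
  define w where "w = unghost (\<lambda>n. h (ghost u n) (ghost v n))"
  have w: "ghost w n = h (ghost u n) (ghost v n)" for n
    unfolding w_def ghost_unghost[OF dw[OF dwork_ghost dwork_ghost]] ..
  define z where "z = Witt (eis_red \<circ> w)"
  have z: "wrep w z" by (simp add: z_def wrep_def)
  have "z' = z" if "?P z'" for z'
  proof -
    from that obtain u' v' w' where *: "wrep u' x" "wrep v' y" "wrep w' z'"
      "\<And>n. ghost w' n = h (ghost u' n) (ghost v' n)" by blast
    have "2 ^ Suc n dvd ghost u' n - ghost u n" "2 ^ Suc n dvd ghost v' n - ghost v n" for n
      using wrep_eq_iff[OF *(1) assms(3)] wrep_eq_iff[OF *(2) assms(4)] by blast+
    then have "\<forall>n. 2 ^ Suc n dvd ghost w' n - ghost w n"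
      unfolding *(4) w by (intro allI cong)
    then show ?thesis using wrep_eq_iff[OF *(3) z] by blast
  qed
  moreover have "?P z" using assms(3,4) z w by blast
  ultimately have "(THE z. ?P z) = z" by (intro the_equality) blast+
  moreover have "witt_op h x y = (THE z. ?P z)" by (simp only: witt_op_def wrep_def)
  ultimately have "witt_op h x y = z" by simp
  with z w show ?thesis by auto
qed

lemma witt_add_rep:
  assumes "wrep u x" "wrep v y"
  shows "\<exists>w. wrep w (witt_op (+) x y) \<and> (\<forall>n. ghost w n = ghost u n + ghost v n)"
proof (rule witt_op_rep[OF _ _ assms])
  fix a b assume "dwork a" "dwork b"
  then have "2 ^ Suc n dvd (a (Suc n) - eis_conj (a n)) + (b (Suc n) - eis_conj (b n))" for n
    unfolding dwork_def by (intro dvd_add) blast+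
  then show "dwork (\<lambda>n. a n + b n)"
    unfolding dwork_def eis_conj_add by (simp only: algebra_simps simp_thms)
next
  fix k and a a' b b' :: eis
  assume "2 ^ k dvd a - a'" "2 ^ k dvd b - b'"
  from dvd_add[OF this] show "2 ^ k dvd a + b - (a' + b')" by (simp only: algebra_simps)
qed

lemma witt_diff_rep:
  assumes "wrep u x" "wrep v y"
  shows "\<exists>w. wrep w (witt_op (-) x y) \<and> (\<forall>n. ghost w n = ghost u n - ghost v n)"
proof (rule witt_op_rep[OF _ _ assms])
  fix a b assume "dwork a" "dwork b"
  then have "2 ^ Suc n dvd (a (Suc n) - eis_conj (a n)) - (b (Suc n) - eis_conj (b n))" for n
    using dvd_diff unfolding dwork_def by blast
  then show "dwork (\<lambda>n. a n - b n)"
    unfolding dwork_def eis_conj_diff by (simp only: algebra_simps simp_thms)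
next
  fix k and a a' b b' :: eis
  assume "2 ^ k dvd a - a'" "2 ^ k dvd b - b'"
  from dvd_diff[OF this] show "2 ^ k dvd a - b - (a' - b')" by (simp only: algebra_simps)
qed

lemma eis_cong_mult:
  assumes "d dvd a - a'" "d dvd b - (b'::eis)" shows "d dvd a * b - a' * b'"
proof -
  have "d dvd (a - a') * b + a' * (b - b')"
    using assms by (intro dvd_add dvd_mult dvd_mult2)
  then show ?thesis by (simp add: algebra_simps)
qed

lemma witt_mult_rep:
  assumes "wrep u x" "wrep v y"
  shows "\<exists>w. wrep w (witt_op (*) x y) \<and> (\<forall>n. ghost w n = ghost u n * ghost v n)"
proof (rule witt_op_rep[OF _ _ assms])
  fix a b assume "dwork a" "dwork b"
  then show "dwork (\<lambda>n. a n * b n)"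
    unfolding dwork_def eis_conj_mult by (intro allI eis_cong_mult) blast+
next
  fix k and a a' b b' :: eis
  assume "2 ^ k dvd a - a'" "2 ^ k dvd b - b'"
  then show "2 ^ k dvd a * b - a' * b'" by (rule eis_cong_mult)
qed

definition teichmueller :: "f4 \<Rightarrow> witt" where
  "teichmueller c = Witt (\<lambda>n. if n = 0 then c else 0)"

lemma wrep_teichmueller:
  "wrep (\<lambda>n. if n = 0 then e else 0) (teichmueller (eis_red e))"
  by (auto simp: wrep_def teichmueller_def fun_eq_iff zero_eis_def zero_f4_def)

lemma ghost_teichmueller:
  "ghost (\<lambda>n. if n = 0 then e else 0) n = e ^ (2 ^ n)"
proof -
  have "ghost (\<lambda>n. if n = 0 then e else 0) n = (\<Sum>i\<le>n. if i = 0 then e ^ (2 ^ n) else 0)"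
    unfolding ghost_def by (intro sum.cong) (auto simp: power_0_left)
  then show ?thesis by simp
qed

instantiation witt :: comm_ring_1
begin
definition "0 = teichmueller 0"
definition "1 = teichmueller 1"
definition "x + y = witt_op (+) x y"
definition "x - y = witt_op (-) x y"
definition "- x = witt_op (-) 0 (x :: witt)"
definition "x * y = witt_op (*) x y"

lemma witt_0_rep: "wrep (\<lambda>n. if n = 0 then 0 else 0) 0"
  using wrep_teichmueller[of 0] by (simp add: zero_witt_def zero_eis_def zero_f4_def)
lemma witt_0_ghost: "ghost (\<lambda>n. if n = 0 then 0 else 0) n = 0"
  by (simp only: ghost_teichmueller) (simp add: power_0_left)
lemma witt_1_rep: "wrep (\<lambda>n. if n = 0 then 1 else 0) 1"
  using wrep_teichmueller[of 1] by (simp add: one_witt_def one_eis_def one_f4_def)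
lemma witt_1_ghost: "ghost (\<lambda>n. if n = 0 then 1 else 0) n = 1"
  by (simp only: ghost_teichmueller) simp

instance
proof
  fix a b c :: witt
  note add = witt_add_rep[folded plus_witt_def]
  note diff = witt_diff_rep[folded minus_witt_def]
  note mult = witt_mult_rep[folded times_witt_def]
  obtain u v w where r: "wrep u a" "wrep v b" "wrep w c" using wrep_exists by metis
  obtain ab where ab: "wrep ab (a * b)" "\<forall>n. ghost ab n = ghost u n * ghost v n"
    using mult[OF r(1,2)] by blast
  obtain bc where bc: "wrep bc (b * c)" "\<forall>n. ghost bc n = ghost v n * ghost w n"
    using mult[OF r(2,3)] by blast
  obtain ac where ac: "wrep ac (a * c)" "\<forall>n. ghost ac n = ghost u n * ghost w n"
    using mult[OF r(1,3)] by blast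
  obtain ba where ba: "wrep ba (b * a)" "\<forall>n. ghost ba n = ghost v n * ghost u n"
    using mult[OF r(2,1)] by blast
  obtain sab where sab: "wrep sab (a + b)" "\<forall>n. ghost sab n = ghost u n + ghost v n"
    using add[OF r(1,2)] by blast
  obtain sbc where sbc: "wrep sbc (b + c)" "\<forall>n. ghost sbc n = ghost v n + ghost w n"
    using add[OF r(2,3)] by blast
  obtain sba where sba: "wrep sba (b + a)" "\<forall>n. ghost sba n = ghost v n + ghost u n"
    using add[OF r(2,1)] by blast
  obtain l r1 where l: "wrep l (a * b * c)" "\<forall>n. ghost l n = ghost ab n * ghost w n"
    "wrep r1 (a * (b * c))" "\<forall>n. ghost r1 n = ghost u n * ghost bc n"
    using mult[OF ab(1) r(3)] mult[OF r(1) bc(1)] by blast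
  show "a * b * c = a * (b * c)"
    by (rule wrep_eqI[OF l(1,3)]) (simp add: l ab bc mult.assoc)
  show "a * b = b * a"
    by (rule wrep_eqI[OF ab(1) ba(1)]) (simp add: ab ba mult.commute)
  obtain m where m: "wrep m (1 * a)" "\<forall>n. ghost m n = 1 * ghost u n"
    using mult[OF witt_1_rep r(1)] unfolding witt_1_ghost by blast
  show "1 * a = a"
    by (rule wrep_eqI[OF m(1) r(1)]) (simp add: m)
  obtain s1 s2 where s: "wrep s1 (a + b + c)" "\<forall>n. ghost s1 n = ghost sab n + ghost w n"
    "wrep s2 (a + (b + c))" "\<forall>n. ghost s2 n = ghost u n + ghost sbc n"
    using add[OF sab(1) r(3)] add[OF r(1) sbc(1)] by blast
  show "a + b + c = a + (b + c)"
    by (rule wrep_eqI[OF s(1,3)]) (simp add: s sab sbc add.assoc)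
  show "a + b = b + a"
    by (rule wrep_eqI[OF sab(1) sba(1)]) (simp add: sab sba add.commute)
  obtain z where z: "wrep z (0 + a)" "\<forall>n. ghost z n = 0 + ghost u n"
    using add[OF witt_0_rep r(1)] unfolding witt_0_ghost by blast
  show "0 + a = a"
    by (rule wrep_eqI[OF z(1) r(1)]) (simp add: z)
  have neg: "\<exists>t. wrep t (- x) \<and> (\<forall>n. ghost t n = - ghost u n)" if "wrep u x" for u x
    using witt_diff_rep[OF witt_0_rep that] unfolding witt_0_ghost uminus_witt_def by simp
  obtain na nb where n: "wrep na (- a)" "\<forall>n. ghost na n = - ghost u n"
    "wrep nb (- b)" "\<forall>n. ghost nb n = - ghost v n"
    using neg[OF r(1)] neg[OF r(2)] by blast
  obtain k where k: "wrep k (- a + a)" "\<forall>n. ghost k n = ghost na n + ghost u n"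
    using add[OF n(1) r(1)] by blast
  show "- a + a = 0"
    by (rule wrep_eqI[OF k(1) witt_0_rep]) (simp only: witt_0_ghost k n ab_left_minus)
  obtain d1 d2 where d: "wrep d1 (a - b)" "\<forall>n. ghost d1 n = ghost u n - ghost v n"
    "wrep d2 (a + - b)" "\<forall>n. ghost d2 n = ghost u n + ghost nb n"
    using diff[OF r(1,2)] add[OF r(1) n(3)] by blast
  show "a - b = a + - b"
    by (rule wrep_eqI[OF d(1,3)]) (simp add: d n)
  obtain p1 p2 where p: "wrep p1 ((a + b) * c)" "\<forall>n. ghost p1 n = ghost sab n * ghost w n"
    "wrep p2 (a * c + b * c)" "\<forall>n. ghost p2 n = ghost ac n + ghost bc n"
    using mult[OF sab(1) r(3)] add[OF ac(1) bc(1)] by blast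
  show "(a + b) * c = a * c + b * c"
    by (rule wrep_eqI[OF p(1,3)]) (simp add: p sab ac bc distrib_right)
  show "(0::witt) \<noteq> 1"
    by (simp add: zero_witt_def one_witt_def teichmueller_def fun_eq_iff)
qed
end

lemma not_4_dvd_1: "\<not> (4::witt) dvd 1"
proof
  assume "(4::witt) dvd 1"
  then obtain k :: witt where k: "1 = (1 + 1 + 1 + 1) * k" by (auto simp: dvd_def)
  note add = witt_add_rep[folded plus_witt_def]
  obtain u2 where u2: "wrep u2 (1 + 1)" "\<forall>n. ghost u2 n = 1 + 1"
    using add[OF witt_1_rep witt_1_rep] unfolding witt_1_ghost by blast
  obtain u3 where u3: "wrep u3 (1 + 1 + 1)" "\<forall>n. ghost u3 n = 1 + 1 + 1"
    using add[OF u2(1) witt_1_rep] u2(2) unfolding witt_1_ghost by auto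
  obtain u4 where u4: "wrep u4 (1 + 1 + 1 + 1)" "\<forall>n. ghost u4 n = 1 + 1 + 1 + 1"
    using add[OF u3(1) witt_1_rep] u3(2) unfolding witt_1_ghost by auto
  obtain v where v: "wrep v k" using wrep_exists by blast
  obtain w where w: "wrep w 1" "\<forall>n. ghost w n = 4 * ghost v n"
    using witt_mult_rep[folded times_witt_def, OF u4(1) v] u4(2) unfolding k[symmetric] by auto
  have "2 ^ Suc 0 dvd 1 - ghost w 0"
    using wrep_eq_iff[OF witt_1_rep w(1)] unfolding witt_1_ghost by blast
  moreover have "2 ^ Suc 0 dvd ghost w 0"
    using w(2) by (metis dvd_mult2 dvd_triv_left mult_2 numeral_Bit0 power_Suc0_right)
  ultimately have "2 ^ Suc 0 dvd (1 - ghost w 0) + ghost w 0" by (rule dvd_add)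
  then have "2 ^ Suc 0 dvd Eis 1 0" by (simp add: one_eis_def)
  then show False unfolding eis_2_power_dvd by simp
qed

text \<open>The ring \<open>W/4W\<close>.\<close>

quotient_type wittmod4 = witt / "\<lambda>x y. 4 dvd x - y"
proof (rule equivpI)
  show "reflp (\<lambda>x y::witt. 4 dvd x - y)" by (rule reflpI) simp
  show "symp (\<lambda>x y::witt. 4 dvd x - y)"
    by (rule sympI) (metis dvd_minus_iff minus_diff_eq)
  show "transp (\<lambda>x y::witt. 4 dvd x - y)"
  proof (rule transpI)
    fix x y z :: witt assume "4 dvd x - y" "4 dvd y - z"
    from dvd_add[OF this] show "4 dvd x - z" by simp
  qed
qed

instantiation wittmod4 :: comm_ring_1
begin
lift_definition zero_wittmod4 :: wittmod4 is 0 .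
lift_definition one_wittmod4 :: wittmod4 is 1 .
lift_definition plus_wittmod4 :: "wittmod4 \<Rightarrow> wittmod4 \<Rightarrow> wittmod4" is "(+)"
  by (metis add_diff_add dvd_add)
lift_definition minus_wittmod4 :: "wittmod4 \<Rightarrow> wittmod4 \<Rightarrow> wittmod4" is "(-)"
proof -
  fix a b c d :: witt assume "4 dvd a - b" "4 dvd c - d"
  from dvd_diff[OF this] show "4 dvd a - c - (b - d)" by (simp add: algebra_simps)
qed
lift_definition uminus_wittmod4 :: "wittmod4 \<Rightarrow> wittmod4" is uminus
  by (metis dvd_minus_iff minus_diff_minus)
lift_definition times_wittmod4 :: "wittmod4 \<Rightarrow> wittmod4 \<Rightarrow> wittmod4" is "(*)"
proof -
  fix a b c d :: witt assume *: "4 dvd a - b" "4 dvd c - d"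
  have "4 dvd (a - b) * c + b * (c - d)" using * by (intro dvd_add dvd_mult dvd_mult2)
  then show "4 dvd a * c - b * d" by (simp add: algebra_simps)
qed
instance
proof
  fix a b c :: wittmod4
  show "a * b * c = a * (b * c)" by transfer (simp add: mult.assoc)
  show "a * b = b * a" by transfer (simp add: mult.commute)
  show "1 * a = a" by transfer simp
  show "a + b + c = a + (b + c)" by transfer (simp add: add.assoc)
  show "a + b = b + a" by transfer (simp add: add.commute)
  show "0 + a = a" by transfer simp
  show "- a + a = 0" by transfer simp
  show "a - b = a + - b" by transfer simp
  show "(a + b) * c = a * c + b * c" by transfer (simp add: distrib_right)
  show "(0::wittmod4) \<noteq> 1" by transfer (use not_4_dvd_1 in auto)
qed
end

abbreviation mod4 :: "witt \<Rightarrow> wittmod4" where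
  "mod4 \<equiv> abs_wittmod4"

text \<open>Multiplication by 2 as a map from \<open>W/2W\<close>, i.e. \<^typ>\<open>f4\<close>, to \<open>W/4W\<close>; any lift of \<open>c\<close> to \<open>W\<close>
  gives the same result.\<close>

definition twice :: "f4 \<Rightarrow> wittmod4" where
  "twice c = mod4 (2 * teichmueller c)"

instantiation witt :: topological_space
begin

definition open_witt :: "witt set \<Rightarrow> bool" where
  "open_witt U \<longleftrightarrow> (\<forall>x\<in>U. \<exists>n. \<forall>y. 2 ^ n dvd y - x \<longrightarrow> y \<in> U)"

instance
proof
  show "open (UNIV :: witt set)" by (simp add: open_witt_def)
next
  fix S T :: "witt set" assume S: "open S" and T: "open T"
  show "open (S \<inter> T)"
    unfolding open_witt_def
  proof
    fix x assume x: "x \<in> S \<inter> T"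
    from S x obtain m where m: "\<forall>y. 2 ^ m dvd y - x \<longrightarrow> y \<in> S" unfolding open_witt_def by blast
    from T x obtain n where n: "\<forall>y. 2 ^ n dvd y - x \<longrightarrow> y \<in> T" unfolding open_witt_def by blast
    have "\<forall>y. 2 ^ (m + n) dvd y - x \<longrightarrow> y \<in> S \<inter> T"
      using m n by (auto simp: power_add dest: dvd_mult_left dvd_mult_right)
    then show "\<exists>n. \<forall>y. 2 ^ n dvd y - x \<longrightarrow> y \<in> S \<inter> T" by blast
  qed
next
  fix K :: "witt set set" assume "\<forall>S\<in>K. open S"
  then show "open (\<Union>K)" unfolding open_witt_def by (meson Union_iff)
qed

end

section \<open>Number fields inside the complex numbers and their Galois groups\<close>

abbreviation CC :: "complex ring" where
  "CC \<equiv> ring_of_type_algebra"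

definition Qbar :: "complex set" where
  "Qbar = {z. algebraic z}"

definition abs_gal :: "complex set \<Rightarrow> (complex \<Rightarrow> complex) monoid" where
  "abs_gal F = BijGroup Qbar
     \<lparr>carrier := {\<sigma> \<in> ring_iso (CC\<lparr>carrier := Qbar\<rparr>) (CC\<lparr>carrier := Qbar\<rparr>) \<inter> extensional Qbar.
                  \<forall>x\<in>F. \<sigma> x = x}\<rparr>"

abbreviation GQ :: "(complex \<Rightarrow> complex) monoid" where
  "GQ \<equiv> abs_gal \<rat>"

text \<open>The Krull topology is the topology of pointwise convergence with \<^const>\<open>Qbar\<close> discrete.\<close>

definition krull :: "(complex \<Rightarrow> complex) topology" where
  "krull = subtopology (product_topology (\<lambda>_. discrete_topology Qbar) Qbar) (carrier GQ)"

text \<open>For a Galois extension \<open>L/F\<close>, the group \<open>Gal(L/F)\<close> as a quotient of the absolute Galois group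
  of \<open>F\<close>, and the projection onto it.\<close>

definition rel_gal :: "complex set \<Rightarrow> complex set \<Rightarrow> (complex \<Rightarrow> complex) set monoid" where
  "rel_gal F L = abs_gal F Mod carrier (abs_gal L)"

definition gal_proj :: "complex set \<Rightarrow> complex set \<Rightarrow> (complex \<Rightarrow> complex) \<Rightarrow> (complex \<Rightarrow> complex) set" where
  "gal_proj F L \<sigma> = carrier (abs_gal L) #>\<^bsub>abs_gal F\<^esub> \<sigma>"

definition galois_extension :: "complex set \<Rightarrow> complex set \<Rightarrow> bool" where
  "galois_extension F L \<longleftrightarrow> subfield F CC \<and> subfield L CC \<and> F \<subseteq> L \<and>
     ring.finite_dimension CC F L \<and> (\<forall>\<sigma>\<in>carrier (abs_gal F). \<sigma> ` L = L)"

definition ring_of_integers :: "complex set \<Rightarrow> complex ring" where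
  "ring_of_integers L = CC\<lparr>carrier := {x \<in> L. algebraic_int x}\<rparr>"

definition primes_above :: "nat \<Rightarrow> complex set \<Rightarrow> complex set set" where
  "primes_above p L = {P. primeideal P (ring_of_integers L) \<and> of_nat p \<in> P}"

definition stays_prime :: "nat \<Rightarrow> complex set \<Rightarrow> bool" where
  "stays_prime p L \<longleftrightarrow> primeideal (PIdl\<^bsub>ring_of_integers L\<^esub> (of_nat p)) (ring_of_integers L)"

text \<open>\<open>p\<close> has \<open>[L : \<rat>]\<close> different primes above it.\<close>

definition splits_completely :: "nat \<Rightarrow> complex set \<Rightarrow> bool" where
  "splits_completely p L \<longleftrightarrow> ring.dimension CC (card (primes_above p L)) \<rat> L"

text \<open>\<open>P\<close> has ramification index 1 over \<open>P \<inter> F\<close>.\<close>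

definition unramified_at :: "complex set \<Rightarrow> complex set \<Rightarrow> complex set \<Rightarrow> bool" where
  "unramified_at F L P \<longleftrightarrow> \<not> P \<inter> F \<subseteq> P \<cdot>\<^bsub>ring_of_integers L\<^esub> P"

text \<open>Every complex embedding of a number field is the restriction of an element of \<^const>\<open>GQ\<close>.\<close>

definition unramified_archimedean :: "complex set \<Rightarrow> complex set \<Rightarrow> bool" where
  "unramified_archimedean F L \<longleftrightarrow> (\<forall>\<sigma>\<in>carrier GQ. \<sigma> ` F \<subseteq> \<real> \<longrightarrow> \<sigma> ` L \<subseteq> \<real>)"

definition totally_real :: "complex set \<Rightarrow> bool" where
  "totally_real L \<longleftrightarrow> (\<forall>\<sigma>\<in>carrier GQ. \<sigma> ` L \<subseteq> \<real>)"

definition is_frobenius :: "complex set \<Rightarrow> complex set \<Rightarrow> complex set \<Rightarrow> (complex \<Rightarrow> complex) \<Rightarrow> bool" where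
  "is_frobenius F L P \<sigma> \<longleftrightarrow> \<sigma> \<in> carrier (abs_gal F) \<and>
     (\<forall>x\<in>carrier (ring_of_integers L). \<sigma> x - x ^ card (carrier (ring_of_integers F Quot (P \<inter> F))) \<in> P)"

definition elementary_abelian_2_extension :: "complex set \<Rightarrow> complex set \<Rightarrow> bool" where
  "elementary_abelian_2_extension F L \<longleftrightarrow> galois_extension F L \<and> comm_group (rel_gal F L) \<and>
     (\<forall>x\<in>carrier (rel_gal F L). x \<otimes>\<^bsub>rel_gal F L\<^esub> x = \<one>\<^bsub>rel_gal F L\<^esub>)"

text \<open>The field \<open>F\<^sup>(\<^sup>p\<^sup>)\<close>, as a compositum.\<close>

definition max_2_extension :: "complex set \<Rightarrow> nat \<Rightarrow> complex set" where
  "max_2_extension F p = generate_field CC (\<Union>{L. elementary_abelian_2_extension F L \<and>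
     (\<forall>P. primeideal P (ring_of_integers L) \<and> P \<noteq> {0} \<and> of_nat p \<notin> P \<longrightarrow> unramified_at F L P) \<and>
     unramified_archimedean F L})"

definition governing_field :: "complex set \<Rightarrow> complex set" where
  "governing_field F = generate_field CC (F \<union> {z. z ^ 2 \<in> Units (ring_of_integers F)})"

definition additive_group :: "'a::ab_group_add monoid" where
  "additive_group = \<lparr>carrier = UNIV, mult = (+), one = 0\<rparr>"

text \<open>Isomorphisms from \<open>Gal(L/F)\<close>, on which the absolute Galois group of \<open>\<rat>\<close> acts by conjugation, to a
  module on which it acts via \<open>act\<close>.\<close>

definition galois_module_iso ::
  "complex set \<Rightarrow> complex set \<Rightarrow> ((complex \<Rightarrow> complex) \<Rightarrow> 'a \<Rightarrow> 'a) \<Rightarrow>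
   ((complex \<Rightarrow> complex) set \<Rightarrow> 'a::ab_group_add) \<Rightarrow> bool" where
  "galois_module_iso F L act \<theta> \<longleftrightarrow> \<theta> \<in> iso (rel_gal F L) additive_group \<and>
     (\<forall>\<tau>\<in>carrier GQ. \<forall>\<sigma>\<in>carrier (abs_gal F).
        \<theta> (gal_proj F L (\<tau> \<otimes>\<^bsub>GQ\<^esub> \<sigma> \<otimes>\<^bsub>GQ\<^esub> inv\<^bsub>GQ\<^esub> \<tau>)) = act \<tau> (\<theta> (gal_proj F L \<sigma>)))"

section \<open>The cubic field, trivial primes\<close>

definition cyclic_cubic_subfield_of_Q_zeta7 :: "complex set \<Rightarrow> bool" where
  "cyclic_cubic_subfield_of_Q_zeta7 K \<longleftrightarrow>
     K \<subseteq> generate_field CC {cis (2 * pi / 7)} \<and> galois_extension \<rat> K \<and>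
     ring.dimension CC 3 \<rat> K \<and> (\<exists>s\<in>carrier (rel_gal \<rat> K). generate (rel_gal \<rat> K) {s} = carrier (rel_gal \<rat> K)) \<and>
     totally_real K"

definition f4_units :: "f4 monoid" where
  "f4_units = \<lparr>carrier = - {0}, mult = (*), one = 1\<rparr>"

definition cubic_character ::
  "complex set \<Rightarrow> (complex \<Rightarrow> complex) set \<Rightarrow> f4 \<Rightarrow> ((complex \<Rightarrow> complex) \<Rightarrow> f4) \<Rightarrow> bool" where
  "cubic_character K s \<alpha> \<psi> \<longleftrightarrow> (\<exists>\<phi>\<in>hom (rel_gal \<rat> K) f4_units. \<phi> s = \<alpha> \<and>
     (\<forall>\<sigma>\<in>carrier GQ. \<psi> \<sigma> = \<phi> (gal_proj \<rat> K \<sigma>)))"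

definition trivial_prime :: "complex set \<Rightarrow> nat \<Rightarrow> bool" where
  "trivial_prime K p \<longleftrightarrow> Factorial_Ring.prime p \<and> p mod 4 = 3 \<and> splits_completely p K"

text \<open>The irreducible two-dimensional \<open>U\<^sub>2\<close> is realised as \<^typ>\<open>f4\<close> with action through \<open>\<psi>\<close>; \<open>(1, 0)\<close> is the only
  nonzero invariant element, so it does not depend on the choice of the isomorphism.\<close>

definition frobenius_1_0 :: "complex set \<Rightarrow> ((complex \<Rightarrow> complex) \<Rightarrow> f4) \<Rightarrow> nat \<Rightarrow> bool" where
  "frobenius_1_0 K \<psi> p \<longleftrightarrow>
     (\<exists>\<Phi>. galois_module_iso K (governing_field K) (\<lambda>\<sigma> (a :: bit, u). (a, \<psi> \<sigma> * u)) \<Phi> \<and>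
        (\<forall>P\<in>primes_above p (governing_field K). \<forall>\<sigma>. is_frobenius K (governing_field K) P \<sigma> \<longrightarrow>
           \<Phi> (gal_proj K (governing_field K) \<sigma>) = (1, 0)))"

section \<open>Representations\<close>

definition GL2 :: "('a::comm_ring_1 ^ 2 ^ 2) monoid" where
  "GL2 = \<lparr>carrier = {A. invertible A}, mult = (**), one = mat 1\<rparr>"

definition mat22 :: "'a::zero \<Rightarrow> 'a \<Rightarrow> 'a \<Rightarrow> 'a \<Rightarrow> 'a ^ 2 ^ 2" where
  "mat22 a b c d = vector [vector [a, b], vector [c, d]]"

definition rho_bar :: "((complex \<Rightarrow> complex) \<Rightarrow> f4) \<Rightarrow> (complex \<Rightarrow> complex) \<Rightarrow> f4 ^ 2 ^ 2" where
  "rho_bar \<psi> \<sigma> = mat22 (\<psi> \<sigma>) 0 0 (inverse (\<psi> \<sigma>))"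

definition ad_cocycle ::
  "((complex \<Rightarrow> complex) \<Rightarrow> f4) \<Rightarrow> ((complex \<Rightarrow> complex) \<Rightarrow> f4 ^ 2 ^ 2) \<Rightarrow> bool" where
  "ad_cocycle \<psi> f \<longleftrightarrow> continuous_map krull (discrete_topology UNIV) f \<and>
     (\<forall>\<sigma>\<in>carrier GQ. \<forall>\<tau>\<in>carrier GQ.
        f (\<sigma> \<otimes>\<^bsub>GQ\<^esub> \<tau>) = f \<sigma> + rho_bar \<psi> \<sigma> ** f \<tau> ** matrix_inv (rho_bar \<psi> \<sigma>))"

text \<open>\<open>f\<close> is a cocycle with values in \<open>{E c}\<close> whose cohomology class restricts on \<open>ker rho_bar\<close> to the
  projection to \<open>Gal(K\<^sup>(\<^sup>p\<^sup>)/K)\<close>, the latter being identified by some isomorphism with \<^typ>\<open>f4\<close>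
  with action through the character \<open>\<eta>\<close>. Coboundaries vanish on \<open>ker rho_bar\<close>, so the
  condition is one on the class, and all cocycles representing the class are covered.\<close>

definition represents_projection_class ::
  "complex set \<Rightarrow> ((complex \<Rightarrow> complex) \<Rightarrow> f4) \<Rightarrow> (f4 \<Rightarrow> f4 ^ 2 ^ 2) \<Rightarrow> ((complex \<Rightarrow> complex) \<Rightarrow> f4) \<Rightarrow>
   nat \<Rightarrow> ((complex \<Rightarrow> complex) \<Rightarrow> f4 ^ 2 ^ 2) \<Rightarrow> bool" where
  "represents_projection_class K \<psi> E \<eta> p f \<longleftrightarrow>
     ad_cocycle \<psi> f \<and> (\<forall>\<sigma>\<in>carrier GQ. f \<sigma> \<in> range E) \<and>
     (\<exists>\<theta>. galois_module_iso K (max_2_extension K p) (\<lambda>\<sigma> c. \<eta> \<sigma> * c) \<theta> \<and>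
        (\<forall>\<sigma>\<in>kernel GQ GL2 (rho_bar \<psi>). f \<sigma> = E (\<theta> (gal_proj K (max_2_extension K p) \<sigma>))))"

definition represents_f12 where
  "represents_f12 K \<psi> = represents_projection_class K \<psi> (\<lambda>c. mat22 0 c 0 0) (\<lambda>\<sigma>. inverse (\<psi> \<sigma>))"

definition represents_f21 where
  "represents_f21 K \<psi> = represents_projection_class K \<psi> (\<lambda>c. mat22 0 0 c 0) \<psi>"

abbreviation sqrt_of :: "nat \<Rightarrow> complex" where
  "sqrt_of l \<equiv> complex_of_real (sqrt (real l))"

definition quad_char :: "nat \<Rightarrow> (complex \<Rightarrow> complex) \<Rightarrow> bit" where
  "quad_char l \<sigma> = (if \<sigma> (sqrt_of l) = sqrt_of l then 0 else 1)"

text \<open>The Teichmueller lift of \<open>\<psi>\<^sup>-\<^sup>1\<close> is the inverse of the Teichmueller lift of \<open>\<psi>\<close>;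
  \<open>F4 b 0\<close> is \<open>b\<close> as an element of the prime field.\<close>

definition xi2 :: "((complex \<Rightarrow> complex) \<Rightarrow> f4) \<Rightarrow> nat \<Rightarrow> (complex \<Rightarrow> complex) \<Rightarrow> wittmod4 ^ 2 ^ 2" where
  "xi2 \<psi> l \<sigma> = mat22
     (mod4 (teichmueller (\<psi> \<sigma>)) * (1 + twice (F4 (quad_char l \<sigma>) 0))) 0
     0 (mod4 (teichmueller (inverse (\<psi> \<sigma>))))"

definition rho2 ::
  "((complex \<Rightarrow> complex) \<Rightarrow> f4) \<Rightarrow> nat \<Rightarrow> ((complex \<Rightarrow> complex) \<Rightarrow> f4 ^ 2 ^ 2) \<Rightarrow>
   ((complex \<Rightarrow> complex) \<Rightarrow> f4 ^ 2 ^ 2) \<Rightarrow> (complex \<Rightarrow> complex) \<Rightarrow> wittmod4 ^ 2 ^ 2" where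
  "rho2 \<psi> l fv fw \<sigma> = (mat 1 + map_matrix twice (fv \<sigma> + fw \<sigma>)) ** xi2 \<psi> l \<sigma>"

definition free_rank_one :: "('a::comm_ring_1 ^ 2) set \<Rightarrow> bool" where
  "free_rank_one M \<longleftrightarrow> (\<exists>u. M = range (\<lambda>c. c *s u) \<and> inj (\<lambda>c. c *s u))"

definition reducible_rep :: "'g set \<Rightarrow> ('g \<Rightarrow> 'a::comm_ring_1 ^ 2 ^ 2) \<Rightarrow> bool" where
  "reducible_rep G \<rho> \<longleftrightarrow> (\<exists>M1 M2. free_rank_one M1 \<and> free_rank_one M2 \<and>
     (\<forall>\<sigma>\<in>G. \<forall>x\<in>M1. \<rho> \<sigma> *v x \<in> M1) \<and>
     (\<forall>x. \<exists>!(x1, x2). x1 \<in> M1 \<and> x2 \<in> M2 \<and> x = x1 + x2))"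

definition irreducible_rep :: "'g set \<Rightarrow> ('g \<Rightarrow> 'a::comm_ring_1 ^ 2 ^ 2) \<Rightarrow> bool" where
  "irreducible_rep G \<rho> \<longleftrightarrow> \<not> reducible_rep G \<rho>"

end

theory Submission
  imports Defs
begin

text \<open>
  A stable line with a free complement is spanned by a vector \<open>u\<close> whose reduction modulo 2 is
  nonzero, and \<open>u\<close> is an eigenvector of every \<open>\<rho> \<sigma>\<close>.  No such vector exists, and the obstruction is
  already visible modulo 4.

  Modulo 2 the representation is \<open>diag(\<psi>, \<psi>\<^sup>-\<^sup>1)\<close>.  Some \<open>\<tau>\<close> has \<open>\<psi> \<tau> = \<alpha>\<close>, of order 3, so the two
  diagonal characters differ and \<open>u\<close> reduces to a multiple of one of the two standard basis vectors.
  Suppose that it is the first one, \<open>u = (a, b)\<close> with \<open>a\<close> a unit and \<open>b\<close> even.  For \<open>\<sigma>\<close> in the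
  kernel of \<open>\<psi>\<close> the eigenvalue is 1 modulo 2, and the second coordinate of the eigenvector equation
  reads \<open>2 d a + b = b\<close> modulo 4, where \<open>d\<close> is the entry of \<open>f\<^sup>(\<^sup>w\<^sup>) \<sigma>\<close> below the diagonal.  Hence \<open>d\<close>
  vanishes on the kernel of \<open>\<psi>\<close>.  In cohomological terms: a stable line lifting the
  first basis vector makes \<open>f\<^sup>(\<^sup>w\<^sup>)\<close> a coboundary, and coboundaries vanish there.  But on the kernel
  \<open>d\<close> is the projection to \<open>Gal(K\<^sup>(\<^sup>w\<^sup>)/K)\<close> followed by an isomorphism to the field with four elements,
  hence onto.  The second basis vector is excluded in the same way by \<open>f\<^sup>(\<^sup>v\<^sup>)\<close>, whose entry is above the diagonal.

  The computation is \<open>stable_line_off_diagonal\<close>; it needs that an element of \<open>W\<close> with zero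
  reduction is divisible by 2, and that 2 is not a zero divisor, both read off from the
  components of \<open>2 x\<close> in \<open>wcomp_double\<close>.  The elements \<open>\<tau>\<close> and \<open>\<sigma>\<close> come from
  \<open>cubic_character_nontrivial\<close> and \<open>projection_class_onto\<close>.
\<close>

text \<open>Without this, every \<open>$\<close> could also be read as a coefficient of a power series, and terms with many
  matrix entries would have exponentially many readings.\<close>

no_notation fps_nth (infixl \<open>$\<close> 75)

section \<open>Reduction of Witt vectors modulo 2\<close>

lemma eis_red_add: "eis_red (x + y) = eis_red x + eis_red y"
  by (cases x; cases y) simp

lemma eis_red_mult: "eis_red (x * y) = eis_red x * eis_red y"
  by (cases x; cases y) simp

definition witt_red :: "witt \<Rightarrow> f4" where
  "witt_red x = wcomp x 0"

lemma witt_red_rep: "wrep u x \<Longrightarrow> witt_red x = eis_red (ghost u 0)"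
  by (auto simp: wrep_def witt_red_def ghost_def fun_eq_iff)

lemma witt_red_add: "witt_red (x + y) = witt_red x + witt_red y"
proof -
  obtain u v where "wrep u x" "wrep v y"
    using wrep_exists by blast
  then show ?thesis
    using witt_add_rep[of u x v y] by (auto simp: witt_red_rep eis_red_add plus_witt_def)
qed

lemma witt_red_mult: "witt_red (x * y) = witt_red x * witt_red y"
proof -
  obtain u v where "wrep u x" "wrep v y"
    using wrep_exists by blast
  then show ?thesis
    using witt_mult_rep[of u x v y] by (auto simp: witt_red_rep eis_red_mult times_witt_def)
qed

lemma f4_add_self: "x + x = (0 :: f4)"
  by (cases x) (simp add: zero_f4_def)

lemma f4_cases: "x = 0 \<or> x = 1 \<or> x = F4 0 1 \<or> x = F4 1 1" for x :: f4
  by (metis (full_types) bit.exhaust f4.exhaust one_f4_def zero_f4_def bit_not_one_iff)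

lemma f4_square_square: "(x ^ 2) ^ 2 = (x :: f4)"
  using f4_cases[of x] by (auto simp: power2_eq_square zero_f4_def one_f4_def)

lemma f4_square_eq_1: "x * x = 1 \<longleftrightarrow> x = (1 :: f4)"
  using f4_cases[of x] by (auto simp: zero_f4_def one_f4_def)

lemma witt_red_0: "witt_red 0 = 0" and witt_red_1: "witt_red 1 = 1"
  by (simp_all add: witt_red_def zero_witt_def one_witt_def teichmueller_def)

lemma witt_red_teichmueller: "witt_red (teichmueller c) = c"
  by (simp add: witt_red_def teichmueller_def)

lemma witt_red_2: "witt_red 2 = 0"
  by (metis f4_add_self one_add_one witt_red_add)

lemma witt_red_diff: "witt_red (x - y) = witt_red x - witt_red y"
  by (metis add_diff_cancel_right' diff_add_cancel witt_red_add)

text \<open>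
  This is \<open>2 = V F\<close>: Frobenius squares the components and Verschiebung shifts them.  The ghost
  components of the shifted squares of \<open>u\<close> are those of \<open>u + u\<close> except for the top summand, and
  the difference \<open>2\<^sup>n\<^sup>+\<^sup>1 u\<^sub>n\<close> is small enough not to change the Witt vector.
\<close>

lemma wcomp_double: "2 * x = Witt (\<lambda>n. case n of 0 \<Rightarrow> 0 | Suc m \<Rightarrow> wcomp x m ^ 2)"
proof -
  obtain u where u: "wrep u x" using wrep_exists by blast
  let ?v = "\<lambda>n. case n of 0 \<Rightarrow> 0 | Suc m \<Rightarrow> u m ^ 2"
  let ?y = "Witt (\<lambda>n. case n of 0 \<Rightarrow> 0 | Suc m \<Rightarrow> wcomp x m ^ 2)"
  have red_sq: "eis_red (e ^ 2) = eis_red e ^ 2" for e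
    by (simp add: power2_eq_square eis_red_mult)
  have v: "wrep ?v ?y"
    using u by (auto simp: wrep_def fun_eq_iff red_sq zero_eis_def zero_f4_def split: nat.split)
  obtain t where t: "wrep t (x + x)" "\<And>n. ghost t n = ghost u n + ghost u n"
    using witt_add_rep[OF u u] by (auto simp: plus_witt_def)
  have gv: "ghost t n - ghost ?v n = 2 ^ Suc n * u n" for n
  proof -
    have "ghost ?v n = (\<Sum>i<n. 2 ^ Suc i * (u i ^ 2) ^ (2 ^ (n - Suc i)))"
      unfolding ghost_def lessThan_Suc_atMost[symmetric] sum.lessThan_Suc_shift by (simp add: zero_power)
    also have "\<dots> = (\<Sum>i<n. 2 * (2 ^ i * u i ^ (2 ^ (n - i))))"
    proof (rule sum.cong[OF refl])
      fix i assume "i \<in> {..<n}"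
      then have "n - i = Suc (n - Suc i)" by simp
      then have "(u i ^ 2) ^ (2 ^ (n - Suc i)) = u i ^ (2 ^ (n - i))"
        by (simp only: power_Suc power_mult)
      then show "2 ^ Suc i * (u i ^ 2) ^ (2 ^ (n - Suc i)) = 2 * (2 ^ i * u i ^ (2 ^ (n - i)))"
        by (simp only: power_Suc mult.assoc)
    qed
    also have "\<dots> = 2 * (ghost u n - 2 ^ n * u n)"
      by (simp add: ghost_def sum_distrib_left flip: lessThan_Suc_atMost)
    finally show ?thesis by (simp add: t algebra_simps)
  qed
  have "x + x = ?y"
    unfolding wrep_eq_iff[OF t(1) v] gv by (intro allI dvd_triv_left)
  then show ?thesis unfolding mult_2 .
qed

lemma wcomp_double_Suc: "wcomp (2 * x) (Suc n) = wcomp x n ^ 2"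
  unfolding wcomp_double by simp

text \<open>
  Squaring is its own inverse on the field with four elements, so half of \<open>x\<close> is found by shifting
  the components back and squaring them.
\<close>

lemma witt_red_eq_0_iff: "witt_red x = 0 \<longleftrightarrow> 2 dvd x"
proof
  assume x: "witt_red x = 0"
  have "wcomp (2 * Witt (\<lambda>n. wcomp x (Suc n) ^ 2)) n = wcomp x n" for n
    unfolding wcomp_double using x
    by (cases n) (simp_all only: witt.sel nat.case f4_square_square witt_red_def)
  then have "2 * Witt (\<lambda>n. wcomp x (Suc n) ^ 2) = x"
    by (intro witt.expand ext)
  then show "2 dvd x" by (rule dvdI[OF sym])
next
  assume "2 dvd x"
  then obtain y where "x = 2 * y" ..
  then show "witt_red x = 0" by (simp only: witt_red_mult witt_red_2 mult_zero_left)
qed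

lemma witt_double_inject: "2 * x = 2 * y \<longleftrightarrow> x = (y :: witt)"
proof
  assume eq: "2 * x = 2 * y"
  have "wcomp x n = wcomp y n" for n
  proof -
    have "wcomp x n ^ 2 = wcomp y n ^ 2"
      unfolding wcomp_double_Suc[symmetric] eq ..
    then have "(wcomp x n ^ 2) ^ 2 = (wcomp y n ^ 2) ^ 2" by (simp only:)
    then show ?thesis unfolding f4_square_square .
  qed
  then show "x = y" by (intro witt.expand ext)
qed simp

lemma even_if_4_dvd_double:
  assumes "4 dvd 2 * x" shows "2 dvd (x :: witt)"
proof -
  have four: "(4 :: witt) = 2 * 2" by simp
  obtain y where "2 * x = 4 * y" using assms ..
  then have "2 * x = 2 * (2 * y)" unfolding four mult.assoc .
  then have "x = 2 * y" unfolding witt_double_inject .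
  then show ?thesis ..
qed

section \<open>Stable lines modulo 4\<close>

text \<open>
  If \<open>a\<close> were a unit, then the eigenvalue \<open>c\<close> would reduce to 1 by the first equation.  Then
  \<open>c - B22\<close> and \<open>b\<close> would both be even, and the second equation would make \<open>B21 * a\<close> vanish modulo 4,
  although \<open>B21\<close> is twice a unit.  Scalars are used in place of a matrix so that the lemma also
  applies with the two coordinates exchanged.
\<close>

lemma stable_line_off_diagonal:
  fixes a b :: witt
  assumes eq: "B11 * a + B12 * b = c * a" "B21 * a + B22 * b = c * b"
    and B: "witt_red B11 = 1" "witt_red B22 = 1" "4 dvd B21 - 2 * x" "witt_red x \<noteq> 0"
    and b: "witt_red b = 0"
  shows "witt_red a = 0"
proof (rule ccontr)
  assume a: "witt_red a \<noteq> 0"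
  have "witt_red a = witt_red c * witt_red a"
    using arg_cong[OF eq(1), of witt_red] B b by (simp add: witt_red_add witt_red_mult)
  then have "witt_red c = 1" using a by simp
  then have "witt_red (c - B22) = 0"
    using B by (simp add: witt_red_diff)
  then have "2 * 2 dvd (c - B22) * b"
    using b unfolding witt_red_eq_0_iff by (rule mult_dvd_mono)
  moreover have "(c - B22) * b = B21 * a"
    using eq(2) by (simp add: algebra_simps)
  ultimately have "4 dvd B21 * a" by simp
  then have "4 dvd B21 * a - (B21 - 2 * x) * a"
    by (rule dvd_diff) (rule dvd_mult2[OF B(3)])
  moreover have "B21 * a - (B21 - 2 * x) * a = 2 * (x * a)"
    by (simp add: algebra_simps)
  ultimately have "4 dvd 2 * (x * a)" by (simp only:)
  then have "witt_red (x * a) = 0"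
    unfolding witt_red_eq_0_iff by (rule even_if_4_dvd_double)
  then show False using a B by (simp add: witt_red_mult)
qed

lemma mod4_eq_iff: "mod4 x = mod4 y \<longleftrightarrow> 4 dvd x - y"
  by (rule wittmod4.abs_eq_iff)

lemma mod4_mult: "mod4 (x * y) = mod4 x * mod4 y"
  by (simp add: times_wittmod4.abs_eq)

lemma mod4_add: "mod4 (x + y) = mod4 x + mod4 y"
  by (simp add: plus_wittmod4.abs_eq)

lemma mod4_0: "mod4 0 = 0" and mod4_1: "mod4 1 = 1"
  by (simp_all add: zero_wittmod4.abs_eq one_wittmod4.abs_eq)

lemma witt_red_cong: "4 dvd x - y \<Longrightarrow> witt_red x = witt_red y"
proof -
  assume "4 dvd x - y"
  then have "2 dvd x - y" using dvd_trans[of 2 4 "x - y"] dvd_triv_left[of "2::witt" 2] by simp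
  then show ?thesis
    unfolding witt_red_eq_0_iff[symmetric] witt_red_diff by simp
qed

lemma witt_red_cong_double: "4 dvd y - 2 * x \<Longrightarrow> witt_red y = 0"
  by (drule witt_red_cong) (simp add: witt_red_mult witt_red_2)

lemma mat22_nth [simp]:
  "mat22 a b c d $ 1 $ 1 = a" "mat22 a b c d $ 1 $ 2 = b"
  "mat22 a b c d $ 2 $ 1 = c" "mat22 a b c d $ 2 $ 2 = d"
  by (simp_all add: mat22_def)

text \<open>
  The off-diagonal entries carry the two cocycles, each multiplied by a diagonal entry of \<open>xi2\<close>; the
  factors \<open>1 + 2 e\<close> from the quadratic character reduce to 1.
\<close>

lemma rho2_lift_entries:
  fixes M :: "witt ^ 2 ^ 2"
  assumes M: "map_matrix mod4 M = rho2 \<psi> l fv fw \<sigma>"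
    and f: "fv \<sigma> = mat22 0 c 0 0" "fw \<sigma> = mat22 0 0 d 0"
  shows "witt_red (M $ 1 $ 1) = \<psi> \<sigma>" "witt_red (M $ 2 $ 2) = inverse (\<psi> \<sigma>)"
    and "\<exists>x. 4 dvd M $ 1 $ 2 - 2 * x \<and> witt_red x = c * inverse (\<psi> \<sigma>)"
    and "\<exists>x. 4 dvd M $ 2 $ 1 - 2 * x \<and> witt_red x = d * \<psi> \<sigma>"
proof -
  define e where "e = teichmueller (F4 (quad_char l \<sigma>) 0)"
  have twice: "twice 0 = 0" "twice a = mod4 (2 * teichmueller a)" for a
    by (simp_all add: twice_def mod4_0 flip: zero_witt_def)
  have entry: "mod4 (M $ i $ j) = rho2 \<psi> l fv fw \<sigma> $ i $ j" for i j
    by (simp add: M[symmetric] map_matrix_def)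
  note expand = rho2_def xi2_def matrix_matrix_mult_def sum_2 mat_def map_matrix_def f
  have "mod4 (M $ 1 $ 1) = mod4 (teichmueller (\<psi> \<sigma>) * (1 + 2 * e))"
    unfolding entry e_def mod4_mult[of "teichmueller _"] mod4_add mod4_1
    by (simp add: expand twice(1)) (simp add: twice(2))
  from witt_red_cong[OF this[unfolded mod4_eq_iff]] show "witt_red (M $ 1 $ 1) = \<psi> \<sigma>"
    by (simp add: witt_red_mult witt_red_add witt_red_1 witt_red_2 witt_red_teichmueller)
  have "mod4 (M $ 2 $ 2) = mod4 (teichmueller (inverse (\<psi> \<sigma>)))"
    unfolding entry by (simp add: expand twice(1))
  from witt_red_cong[OF this[unfolded mod4_eq_iff]] show "witt_red (M $ 2 $ 2) = inverse (\<psi> \<sigma>)"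
    by (simp add: witt_red_teichmueller)
  have "mod4 (M $ 1 $ 2) = mod4 (2 * teichmueller c * teichmueller (inverse (\<psi> \<sigma>)))"
    unfolding entry mod4_mult[of "2 * _"] by (simp add: expand twice(1)) (simp add: twice(2))
  then show "\<exists>x. 4 dvd M $ 1 $ 2 - 2 * x \<and> witt_red x = c * inverse (\<psi> \<sigma>)"
    unfolding mod4_eq_iff
    by (intro exI[of _ "teichmueller c * teichmueller (inverse (\<psi> \<sigma>))"])
      (simp add: witt_red_mult witt_red_teichmueller mult.assoc)
  have "mod4 (M $ 2 $ 1) = mod4 (2 * teichmueller d * (teichmueller (\<psi> \<sigma>) * (1 + 2 * e)))"
    unfolding entry e_def mod4_mult[of "2 * teichmueller d"] mod4_mult[of "teichmueller _"] mod4_add mod4_1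
    by (simp add: expand twice(1)) (simp add: twice(2))
  then show "\<exists>x. 4 dvd M $ 2 $ 1 - 2 * x \<and> witt_red x = d * \<psi> \<sigma>"
    unfolding mod4_eq_iff
    by (intro exI[of _ "teichmueller d * (teichmueller (\<psi> \<sigma>) * (1 + 2 * e))"])
      (simp add: witt_red_mult witt_red_teichmueller witt_red_add witt_red_1 witt_red_2 mult.assoc)
qed

text \<open>If \<open>u\<close> were even, then every vector would reduce to a multiple of \<open>u'\<close>, in particular both
  standard basis vectors.\<close>

lemma free_complement_unimodular:
  fixes M1 M2 :: "(witt ^ 2) set" and u u' :: "witt ^ 2"
  assumes "M1 = range (\<lambda>c. c *s u)" "M2 = range (\<lambda>c. c *s u')"
    and dec: "\<And>x. \<exists>x1\<in>M1. \<exists>x2\<in>M2. x = x1 + x2"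
  shows "witt_red (u $ 1) \<noteq> 0 \<or> witt_red (u $ 2) \<noteq> 0"
proof (rule ccontr)
  assume "\<not> ?thesis"
  then have u: "witt_red (u $ 1) = 0" "witt_red (u $ 2) = 0" by auto
  have ex: "\<exists>k. witt_red (x $ 1) = k * witt_red (u' $ 1) \<and> witt_red (x $ 2) = k * witt_red (u' $ 2)"
    for x :: "witt ^ 2"
  proof -
    obtain x1 x2 where "x1 \<in> M1" "x2 \<in> M2" "x = x1 + x2" using dec by metis
    then obtain c k where "x = c *s u + k *s u'" unfolding assms(1,2) by auto
    then have "x $ i = c * u $ i + k * u' $ i" for i by simp
    then have "witt_red (x $ 1) = witt_red k * witt_red (u' $ 1)" "witt_red (x $ 2) = witt_red k * witt_red (u' $ 2)"
      using u by (simp_all add: witt_red_add witt_red_mult)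
    then show ?thesis by blast
  qed
  obtain k where k: "1 = k * witt_red (u' $ 1)" "0 = k * witt_red (u' $ 2)"
    using ex[of "vector [1, 0]"] by (simp add: witt_red_0 witt_red_1) blast
  obtain k' where k': "1 = k' * witt_red (u' $ 2)"
    using ex[of "vector [0, 1]"] by (simp add: witt_red_0 witt_red_1) blast
  show False
    using k k' by auto
qed

section \<open>The field of algebraic numbers\<close>

lemma CC_simps [simp]: "carrier CC = UNIV" "mult CC = (*)" "one CC = 1" "add CC = (+)" "zero CC = 0"
  by (simp_all add: ring_of_type_algebra_def)

interpretation CC: ring CC by (rule ring_from_type_algebra)

lemma CC_nat_pow: "x [^]\<^bsub>CC\<^esub> (n::nat) = x ^ n"
  by (induction n) (simp_all add: mult.commute)

lemma CC_eval: "CC.eval xs x = poly (Poly (rev xs)) x"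
  by (induction xs) (simp_all add: Poly_snoc poly_monom CC_nat_pow)

lemma CC_a_inv: "\<ominus>\<^bsub>CC\<^esub> x = - x"
  by (rule CC.minus_equality) simp_all

lemma CC_m_inv: "x \<noteq> 0 \<Longrightarrow> inv\<^bsub>CC\<^esub> x = inverse x"
  by (rule CC.inv_char) simp_all

lemma rats_subfield: "subfield \<rat> CC"
  by (intro field.subfieldI'[OF field_from_type_algebra] CC.subringI) (auto simp: CC_a_inv CC_m_inv)

text \<open>
  Links the two notions of algebraicity, roots of a coefficient list over \<open>\<rat>\<close> inside the ring
  \<open>CC\<close> and roots of a polynomial with integer coefficients, so that closure under sums and products can
  be taken from the theory of field extensions.
\<close>

lemma CC_algebraic_iff: "(CC.algebraic over \<rat>) x \<longleftrightarrow> algebraic x"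
proof
  assume "(CC.algebraic over \<rat>) x"
  then obtain p where p: "p \<in> carrier (\<rat>[X]\<^bsub>CC\<^esub>)" "p \<noteq> []" "CC.eval p x = 0"
    using domain.algebraicE[OF field.axioms(1)[OF field_from_type_algebra] subfieldE(1)[OF rats_subfield], of x] by auto
  then have sub: "set p \<subseteq> \<rat>" and hd: "hd p \<noteq> 0"
    by (auto simp: polynomial_def simp flip: univ_poly_carrier)
  have "poly.coeff (Poly (rev p)) i \<in> \<rat>" for i
    using sub nth_mem[of i "rev p"] by (auto simp: nth_default_def)
  moreover have "poly.coeff (Poly (rev p)) (length p - 1) = hd p"
    using p(2) by (cases p) (simp_all add: nth_default_append)
  then have "Poly (rev p) \<noteq> 0" using hd by (metis coeff_0)
  ultimately show "algebraic x"
    using p(3) unfolding algebraic_altdef CC_eval by blast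
next
  assume "algebraic x"
  then obtain p where p: "\<And>i. poly.coeff p i \<in> \<rat>" "p \<noteq> 0" "poly p x = 0"
    unfolding algebraic_altdef by blast
  have "rev (coeffs p) \<in> carrier (\<rat>[X]\<^bsub>CC\<^esub>)"
    using p(1,2) by (auto simp: polynomial_def hd_rev last_coeffs_eq_coeff_degree coeffs_def
        simp flip: univ_poly_carrier)
  then show "(CC.algebraic over \<rat>) x"
  proof (rule CC.algebraicI)
    show "rev (coeffs p) \<noteq> []" using p(2) by simp
    show "CC.eval (rev (coeffs p)) x = \<zero>\<^bsub>CC\<^esub>" using p(3) unfolding CC_eval by simp
  qed
qed

lemma Qbar_subfield: "subfield Qbar CC"
proof -
  have "subfield {x \<in> carrier CC. (CC.algebraic over \<rat>) x} CC"
    by (rule field.subfield_of_algebraics[OF field_from_type_algebra rats_subfield])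
  also have "{x \<in> carrier CC. (CC.algebraic over \<rat>) x} = Qbar"
    by (auto simp: CC_algebraic_iff Qbar_def)
  finally show ?thesis .
qed

lemma Qbar_closed:
  "1 \<in> Qbar" "x \<in> Qbar \<Longrightarrow> y \<in> Qbar \<Longrightarrow> x + y \<in> Qbar" "x \<in> Qbar \<Longrightarrow> y \<in> Qbar \<Longrightarrow> x * y \<in> Qbar"
  using subringE(3,6,7)[OF subfieldE(1)[OF Qbar_subfield]] by auto

section \<open>Absolute Galois groups and the characters\<close>

lemma abs_gal_carrier:
  "carrier (abs_gal F) = {\<sigma> \<in> Bij Qbar. (\<forall>x\<in>Qbar. \<forall>y\<in>Qbar. \<sigma> (x + y) = \<sigma> x + \<sigma> y \<and> \<sigma> (x * y) = \<sigma> x * \<sigma> y)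
      \<and> \<sigma> 1 = 1 \<and> (\<forall>x\<in>F. \<sigma> x = x)}"
  by (auto simp: abs_gal_def ring_iso_def ring_hom_def Bij_def bij_betw_def)

text \<open>
  Elements of \<open>abs_gal F\<close> are undefined outside the algebraic numbers, so the hypothesis
  is what makes the identity among them fix \<open>F\<close>.
\<close>

lemma subgroup_abs_gal:
  assumes "F \<subseteq> Qbar"
  shows "subgroup (carrier (abs_gal F)) (BijGroup Qbar)"
proof (rule group.subgroupI[OF group_BijGroup])
  show "carrier (abs_gal F) \<subseteq> carrier (BijGroup Qbar)"
    by (auto simp: abs_gal_carrier BijGroup_def)
  have "(\<lambda>x\<in>Qbar. x) \<in> carrier (abs_gal F)"
    using assms by (auto simp: abs_gal_carrier id_Bij Qbar_closed)
  then show "carrier (abs_gal F) \<noteq> {}" by blast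
next
  fix \<sigma> assume \<sigma>: "\<sigma> \<in> carrier (abs_gal F)"
  then have bij: "\<sigma> \<in> Bij Qbar" by (simp add: abs_gal_carrier)
  then have inj: "inj_on \<sigma> Qbar" by (simp add: Bij_def bij_betw_def)
  have fix_inv: "inv_into Qbar \<sigma> x = x" if "x \<in> Qbar" "\<sigma> x = x" for x
    using inv_into_f_f[OF inj that(1)] that(2) by simp
  have "inv_into Qbar \<sigma> (x + y) = inv_into Qbar \<sigma> x + inv_into Qbar \<sigma> y"
    "inv_into Qbar \<sigma> (x * y) = inv_into Qbar \<sigma> x * inv_into Qbar \<sigma> y"
    if "x \<in> Qbar" "y \<in> Qbar" for x y
    using \<sigma> that bij by (auto intro!: Bij_inv_into_lemma simp: abs_gal_carrier Qbar_closed)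
  then show "inv\<^bsub>BijGroup Qbar\<^esub> \<sigma> \<in> carrier (abs_gal F)"
    using \<sigma> assms unfolding inv_BijGroup[OF bij] abs_gal_carrier
    by (auto simp: restrict_inv_into_Bij Qbar_closed fix_inv)
next
  fix \<sigma> \<tau> assume *: "\<sigma> \<in> carrier (abs_gal F)" "\<tau> \<in> carrier (abs_gal F)"
  then have bij: "\<sigma> \<in> Bij Qbar" "\<tau> \<in> Bij Qbar" by (simp_all add: abs_gal_carrier)
  have "\<tau> x \<in> Qbar" if "x \<in> Qbar" for x
    using Bij_imp_funcset[OF bij(2)] that by auto
  then have "compose Qbar \<sigma> \<tau> \<in> carrier (abs_gal F)"
    using * assms by (auto simp: abs_gal_carrier compose_Bij compose_eq Qbar_closed)
  then show "\<sigma> \<otimes>\<^bsub>BijGroup Qbar\<^esub> \<tau> \<in> carrier (abs_gal F)"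
    using bij by (simp add: BijGroup_def)
qed

lemma group_abs_gal:
  assumes "F \<subseteq> Qbar"
  shows "group (abs_gal F)"
  using subgroup.subgroup_is_group[OF subgroup_abs_gal[OF assms] group_BijGroup]
  by (simp add: abs_gal_def)

lemma abs_gal_mono:
  "F \<subseteq> L \<Longrightarrow> carrier (abs_gal L) \<subseteq> carrier (abs_gal F)"
  by (auto simp: abs_gal_carrier)

lemma subgroup_abs_gal_mono:
  assumes "F \<subseteq> L" "L \<subseteq> Qbar"
  shows "subgroup (carrier (abs_gal L)) (abs_gal F)"
  using group.subgroup_incl[OF group_BijGroup subgroup_abs_gal subgroup_abs_gal abs_gal_mono[OF assms(1)]]
    assms by (simp add: abs_gal_def)

lemma cyclotomic_subfield_algebraic:
  assumes "n > 0"
  shows "generate_field CC {cis (2 * pi / real n)} \<subseteq> Qbar"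
proof (rule field.generate_field_min_subfield1[OF field_from_type_algebra _ Qbar_subfield])
  have "cis (2 * pi / real n) ^ n = 1"
    unfolding Complex.DeMoivre using assms by simp
  then have root: "poly (Polynomial.monom 1 n - 1) (cis (2 * pi / real n)) = 0"
    by (simp add: poly_monom)
  have "poly.coeff (Polynomial.monom 1 n - 1 :: complex poly) i \<in> \<int>" for i
    by auto
  moreover have "poly.coeff (Polynomial.monom 1 n - 1 :: complex poly) n = 1"
    using assms by simp
  then have "Polynomial.monom 1 n - 1 \<noteq> (0 :: complex poly)"
    by (metis poly_0_coeff_0 coeff_0 zero_neq_one)
  ultimately have "algebraic (cis (2 * pi / real n))"
    using root by (rule algebraicI)
  then show "{cis (2 * pi / real n)} \<subseteq> Qbar" by (simp add: Qbar_def)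
qed simp

text \<open>The coset of \<open>\<sigma>\<close> is the subgroup itself, which is idempotent in the quotient, and 1 is the only nonzero idempotent of a field.\<close>

lemma cubic_character_trivial:
  assumes psi: "cubic_character K s \<alpha> \<psi>" and K: "\<rat> \<subseteq> K" "K \<subseteq> Qbar" and \<sigma>: "\<sigma> \<in> carrier (abs_gal K)"
  shows "\<psi> \<sigma> = 1"
proof -
  interpret GQ: group GQ by (rule group_abs_gal) (use K in blast)
  let ?H = "carrier (abs_gal K)"
  have H: "subgroup ?H GQ" by (rule subgroup_abs_gal_mono[OF K])
  obtain \<phi> where \<phi>: "\<phi> \<in> hom (rel_gal \<rat> K) f4_units"
    "\<And>\<sigma>. \<sigma> \<in> carrier GQ \<Longrightarrow> \<psi> \<sigma> = \<phi> (gal_proj \<rat> K \<sigma>)"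
    using psi by (auto simp: cubic_character_def)
  have \<sigma>': "\<sigma> \<in> carrier GQ" using subgroup.subset[OF H] \<sigma> by auto
  then have "gal_proj \<rat> K \<sigma> = ?H"
    unfolding gal_proj_def by (rule GQ.coset_join2[OF _ H \<sigma>])
  with \<phi> \<sigma>' have "\<psi> \<sigma> = \<phi> ?H" by simp
  moreover have in_c: "?H \<in> carrier (rel_gal \<rat> K)"
    using GQ.rcosetsI[OF subgroup.subset[OF H] GQ.one_closed] GQ.coset_join2[OF GQ.one_closed H]
      subgroup.one_closed[OF H] by (simp add: rel_gal_def FactGroup_def)
  have "?H \<otimes>\<^bsub>rel_gal \<rat> K\<^esub> ?H = ?H"
    using GQ.subgroup_mult_id[OF H] by (simp add: rel_gal_def)
  then have "\<phi> ?H * \<phi> ?H = \<phi> ?H"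
    using hom_mult[OF \<phi>(1) in_c in_c] by (simp add: f4_units_def)
  moreover have "\<phi> ?H \<noteq> 0"
    using hom_in_carrier[OF \<phi>(1) in_c] by (simp add: f4_units_def)
  ultimately show ?thesis by simp
qed

lemma cubic_character_nontrivial:
  assumes "cubic_character K s \<alpha> \<psi>" "s \<in> carrier (rel_gal \<rat> K)"
  shows "\<exists>\<tau>\<in>carrier GQ. \<psi> \<tau> = \<alpha>"
  using assms by (auto simp: cubic_character_def rel_gal_def FactGroup_def RCOSETS_def gal_proj_def)

text \<open>
  Surjectivity of the isomorphism with \<open>Gal(K\<^sup>(\<^sup>p\<^sup>)/K)\<close>; its elements have representatives in the
  absolute Galois group of \<open>K\<close>, which lies in the kernel of \<open>rho_bar\<close>.
\<close>

lemma projection_class_onto: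
  assumes f: "represents_projection_class K \<psi> E \<eta> p f"
    and "\<rat> \<subseteq> K" and triv: "\<And>\<sigma>. \<sigma> \<in> carrier (abs_gal K) \<Longrightarrow> \<psi> \<sigma> = 1"
  shows "\<exists>\<sigma>\<in>carrier GQ. \<psi> \<sigma> = 1 \<and> f \<sigma> = E c"
proof -
  let ?L = "max_2_extension K p"
  obtain \<theta> where \<theta>: "galois_module_iso K ?L (\<lambda>\<sigma> c. \<eta> \<sigma> * c) \<theta>"
    "\<And>\<sigma>. \<sigma> \<in> kernel GQ GL2 (rho_bar \<psi>) \<Longrightarrow> f \<sigma> = E (\<theta> (gal_proj K ?L \<sigma>))"
    using f by (auto simp: represents_projection_class_def)
  have "c \<in> \<theta> ` carrier (rel_gal K ?L)"
    using \<theta>(1) by (auto simp: galois_module_iso_def iso_def bij_betw_def additive_group_def)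
  then obtain \<sigma> where \<sigma>: "\<sigma> \<in> carrier (abs_gal K)" "\<theta> (gal_proj K ?L \<sigma>) = c"
    by (auto simp: rel_gal_def FactGroup_def RCOSETS_def gal_proj_def)
  have "\<sigma> \<in> carrier GQ"
    using abs_gal_mono[OF \<open>\<rat> \<subseteq> K\<close>] \<sigma>(1) by auto
  moreover have "rho_bar \<psi> \<sigma> = mat 1"
    by (simp add: vec_eq_iff forall_2 rho_bar_def triv[OF \<sigma>(1)] mat_def)
  ultimately show ?thesis
    using \<theta>(2)[of \<sigma>] \<sigma> triv by (auto simp: kernel_def GL2_def)
qed

section \<open>Irreducibility\<close>

theorem proposition30:
  fixes K :: "complex set"
    and s :: "(complex \<Rightarrow> complex) set"
    and \<alpha> :: f4
    and \<psi> :: "(complex \<Rightarrow> complex) \<Rightarrow> f4"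
    and l v w :: nat
    and fv fw :: "(complex \<Rightarrow> complex) \<Rightarrow> f4 ^ 2 ^ 2"
    and \<rho> :: "(complex \<Rightarrow> complex) \<Rightarrow> witt ^ 2 ^ 2"
  assumes K: "cyclic_cubic_subfield_of_Q_zeta7 K"
    and generator: "s \<in> carrier (rel_gal \<rat> K)" "generate (rel_gal \<rat> K) {s} = carrier (rel_gal \<rat> K)"
    and primitive: "\<alpha> ^ 3 = 1" "\<alpha> \<noteq> 1"
    and psi: "cubic_character K s \<alpha> \<psi>"
    and l: "Factorial_Ring.prime l" "l mod 8 = 1" "stays_prime l K"
    and v: "trivial_prime K v" "frobenius_1_0 K \<psi> v"
      "stays_prime v (generate_field CC {sqrt_of l})"
    and w: "trivial_prime K w" "frobenius_1_0 K \<psi> w"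
      "stays_prime w (generate_field CC {sqrt_of l})" "splits_completely w (max_2_extension K v)"
    and fv: "represents_f12 K \<psi> v fv"
    and fw: "represents_f21 K \<psi> w fw"
    and rep: "\<rho> \<in> hom GQ GL2"
    and continuous: "continuous_map krull euclidean \<rho>"
    and lift: "\<forall>\<sigma>\<in>carrier GQ. map_matrix mod4 (\<rho> \<sigma>) = rho2 \<psi> l fv fw \<sigma>"
  shows "irreducible_rep (carrier GQ) \<rho>"
proof -
  have "\<rat> \<subseteq> K"
    using K by (simp add: cyclic_cubic_subfield_of_Q_zeta7_def galois_extension_def)
  have "K \<subseteq> Qbar"
    using K cyclotomic_subfield_algebraic[of 7] by (auto simp: cyclic_cubic_subfield_of_Q_zeta7_def)
  note triv = cubic_character_trivial[OF psi \<open>\<rat> \<subseteq> K\<close> this]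
  obtain \<tau> where \<tau>: "\<tau> \<in> carrier GQ" "\<psi> \<tau> = \<alpha>"
    using cubic_character_nontrivial[OF psi generator(1)] by blast
  have fv12: "\<exists>c. fv \<sigma> = mat22 0 c 0 0" and fw21: "\<exists>d. fw \<sigma> = mat22 0 0 d 0" if "\<sigma> \<in> carrier GQ" for \<sigma>
    using fv fw that
    by (auto simp: represents_f12_def represents_f21_def represents_projection_class_def)
  obtain \<sigma>v where \<sigma>v: "\<sigma>v \<in> carrier GQ" "\<psi> \<sigma>v = 1" "fv \<sigma>v = mat22 0 1 0 0"
    using projection_class_onto[OF fv[unfolded represents_f12_def] \<open>\<rat> \<subseteq> K\<close> triv, of 1] by blast
  obtain \<sigma>w where \<sigma>w: "\<sigma>w \<in> carrier GQ" "\<psi> \<sigma>w = 1" "fw \<sigma>w = mat22 0 0 1 0"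
    using projection_class_onto[OF fw[unfolded represents_f21_def] \<open>\<rat> \<subseteq> K\<close> triv, of 1] by blast
  have False if red: "reducible_rep (carrier GQ) \<rho>"
  proof -
    obtain M1 M2 where free: "free_rank_one M1" "free_rank_one M2"
      and stable: "\<forall>\<sigma>\<in>carrier GQ. \<forall>x\<in>M1. \<rho> \<sigma> *v x \<in> M1"
      and dec: "\<forall>x. \<exists>!(x1, x2). x1 \<in> M1 \<and> x2 \<in> M2 \<and> x = x1 + x2"
      using red unfolding reducible_rep_def by (elim exE conjE) (rule that)
    obtain u where u: "M1 = range (\<lambda>c. c *s u)"
      using free(1) unfolding free_rank_one_def by (elim exE conjE) (rule that)
    obtain u' where u': "M2 = range (\<lambda>c. c *s u')"
      using free(2) unfolding free_rank_one_def by (elim exE conjE) (rule that)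
    have "\<exists>x1\<in>M1. \<exists>x2\<in>M2. x = x1 + x2" for x
      using ex1_implies_ex[OF dec[rule_format, of x]] by (elim exE) (auto split: prod.splits)
    note unimod = free_complement_unimodular[OF u u' this]
    define a b where "a = u $ 1" and "b = u $ 2"
    note unimod = unimod[folded a_def b_def]
    have eigen: "\<exists>c. \<rho> \<sigma> $ 1 $ 1 * a + \<rho> \<sigma> $ 1 $ 2 * b = c * a \<and>
        \<rho> \<sigma> $ 2 $ 1 * a + \<rho> \<sigma> $ 2 $ 2 * b = c * b" if "\<sigma> \<in> carrier GQ" for \<sigma>
    proof -
      have "u \<in> M1" unfolding u by (rule range_eqI[of _ _ 1]) simp
      with stable that have "\<rho> \<sigma> *v u \<in> M1" by simp
      then obtain c where "\<rho> \<sigma> *v u = c *s u" unfolding u by (rule rangeE)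
      then show ?thesis
        by (auto simp: vec_eq_iff forall_2 matrix_vector_mult_def sum_2 a_def b_def)
    qed
    \<comment> \<open>The diagonal characters \<open>\<psi>\<close> and \<open>\<psi>\<^sup>-\<^sup>1\<close> differ at \<open>\<tau>\<close>.\<close>
    have line: "witt_red a = 0 \<or> witt_red b = 0"
    proof (rule ccontr)
      assume *: "\<not> ?thesis"
      obtain c d where "fv \<tau> = mat22 0 c 0 0" "fw \<tau> = mat22 0 0 d 0"
        using fv12[OF \<tau>(1)] fw21[OF \<tau>(1)] by (elim exE) (rule that)
      note entries = rho2_lift_entries[OF lift[rule_format, OF \<tau>(1)], OF this]
      obtain k where k: "\<rho> \<tau> $ 1 $ 1 * a + \<rho> \<tau> $ 1 $ 2 * b = k * a" "\<rho> \<tau> $ 2 $ 1 * a + \<rho> \<tau> $ 2 $ 2 * b = k * b"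
        using eigen[OF \<tau>(1)] by (elim exE conjE) (rule that)
      have off: "witt_red (\<rho> \<tau> $ 1 $ 2) = 0" "witt_red (\<rho> \<tau> $ 2 $ 1) = 0"
        using entries(3,4) by (blast dest: witt_red_cong_double)+
      have "witt_red k * witt_red a = \<alpha> * witt_red a"
        using arg_cong[OF k(1), of witt_red, symmetric]
        by (simp only: witt_red_add witt_red_mult off entries(1) \<tau>(2) mult_zero_left add_0_right)
      then have "\<alpha> = witt_red k" using * by simp
      have "witt_red k * witt_red b = inverse \<alpha> * witt_red b"
        using arg_cong[OF k(2), of witt_red, symmetric]
        by (simp only: witt_red_add witt_red_mult off entries(2) \<tau>(2) mult_zero_left add_0_left)
      then have "inverse \<alpha> = witt_red k" using * by simp
      with \<open>\<alpha> = witt_red k\<close> have "inverse \<alpha> = \<alpha>" by (simp only:)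
      moreover have "\<alpha> \<noteq> 0"
      proof
        assume "\<alpha> = 0"
        with primitive(1) show False by (simp add: power3_eq_cube)
      qed
      ultimately have "\<alpha> * \<alpha> = 1" by (metis right_inverse)
      then show False using primitive by (simp add: f4_square_eq_1)
    qed
    show False
    proof (cases "witt_red b = 0")
      case True
      obtain c where "fv \<sigma>w = mat22 0 c 0 0"
        using fv12[OF \<sigma>w(1)] by (elim exE) (rule that)
      note entries = rho2_lift_entries[OF lift[rule_format, OF \<sigma>w(1)], OF this \<sigma>w(3), unfolded \<sigma>w(2)]
      obtain k where k: "\<rho> \<sigma>w $ 1 $ 1 * a + \<rho> \<sigma>w $ 1 $ 2 * b = k * a" "\<rho> \<sigma>w $ 2 $ 1 * a + \<rho> \<sigma>w $ 2 $ 2 * b = k * b"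
        using eigen[OF \<sigma>w(1)] by (elim exE conjE) (rule that)
      obtain x where x: "4 dvd \<rho> \<sigma>w $ 2 $ 1 - 2 * x" "witt_red x = 1"
        using entries(4) by auto
      have "witt_red a = 0"
        by (rule stable_line_off_diagonal[OF k _ _ x(1)]) (use entries x True in auto)
      with True unimod show False by simp
    next
      case False
      with line have a: "witt_red a = 0" by simp
      obtain d where "fw \<sigma>v = mat22 0 0 d 0"
        using fw21[OF \<sigma>v(1)] by (elim exE) (rule that)
      note entries = rho2_lift_entries[OF lift[rule_format, OF \<sigma>v(1)], OF \<sigma>v(3) this, unfolded \<sigma>v(2)]
      obtain k where k: "\<rho> \<sigma>v $ 1 $ 1 * a + \<rho> \<sigma>v $ 1 $ 2 * b = k * a" "\<rho> \<sigma>v $ 2 $ 1 * a + \<rho> \<sigma>v $ 2 $ 2 * b = k * b"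
        using eigen[OF \<sigma>v(1)] by (elim exE conjE) (rule that)
      obtain x where x: "4 dvd \<rho> \<sigma>v $ 1 $ 2 - 2 * x" "witt_red x = 1"
        using entries(3) by auto
      have "witt_red b = 0"
        by (rule stable_line_off_diagonal[of "\<rho> \<sigma>v $ 2 $ 2" b "\<rho> \<sigma>v $ 2 $ 1" a k, OF _ _ _ _ x(1)])
          (use entries x a k in \<open>auto simp: add.commute\<close>)
      with False show False by simp
    qed
  qed
  then show ?thesis by (auto simp: irreducible_rep_def)
qed

end
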